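(* Let $l>0$ and $\kappa_{\text{met}},\kappa_{\text{cer}}>0$. The sequence $(\kappa^{\text{dummy}}(n))_{n\in\mathbb{N}}$ defined by the one dimensional embedded cell algorithm converges to $$\kappa^{\text{dummy}}=\left(\frac{|\Omega_m|}{\kappa_{\text{met}}}+\frac{|\Omega_c|}{\kappa_{\text{cer}}}\right)^{-1},$$ and the sequence $(F^n)_{n\in\mathbb{N}}$ defined by the same algorithm converges to $$F^{\text{ECM}}=l\left(\frac{|\Omega_m|}{\kappa_{\text{met}}}+\frac{|\Omega_c|}{\kappa_{\text{cer}}}\right)^{-1}.$$ Moreover, $\kappa^{\text{dummy}}=\kappa^{\text{hom}}$ and $F^{\text{ECM}}=F^{\text{hom}}$.
   Context: Let $\Omega=(0,1)$ and, for $l\in\mathbb{R}$, $\mathcal{W}_l=\{u\in H^1(0,1): u(0)=0,\ u(1)=l\}$. For a step function $\kappa$ on $\Omega$ with positive values, the weak solution of the one dimensional tensile test is the unique $u\in\mathcal{W}_l$ with $\int_0^1\kappa u'v'\,dx=0$ for all $v\in\mathcal{W}_0$; the tensile force is $F[\kappa,l]=\kappa(1)u'(1)$ in the trace sense (the function $\kappa u'$ is a.e. equal to a constant, and $F[\kappa,l]$ is that constant). $\Omega_m,\Omega_c\subset\Omega$ are the (disjoint) regions occupied by metal and ceramic, $\Omega_m\cup\Omega_c=\Omega$; $|\cdot|$ denotes length, so $|\Omega_m|+|\Omega_c|=1$. The constants $\kappa_{\text{met}},\kappa_{\text{cer}}>0$ are the longitudinal moduli of metal and ceramic. Homogenized quantities: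 let $\kappa:\mathbb{R}\to\{\kappa_{\text{met}},\kappa_{\text{cer}}\}$ be the 1-periodic function with $\kappa=\kappa_{\text{met}}$ on $[q,q+|\Omega_m|)$ and $\kappa=\kappa_{\text{cer}}$ on $[q+|\Omega_m|,q+1)$ for $q\in\mathbb{Z}$. Put $\kappa^\delta(x)=\kappa(x/\delta)$ and let $u^\delta\in\mathcal{W}_l$ be the corresponding weak solution. The constant $\kappa^{\text{hom}}$ and the function $u^{\text{hom}}\in\mathcal{W}_l$ are determined by $u^\delta\rightharpoonup u^{\text{hom}}$ weakly in $H^1(\Omega)$ and $\kappa^\delta(u^\delta)'\rightharpoonup\kappa^{\text{hom}}(u^{\text{hom}})'$ weakly in $L^2(\Omega)$ as $\delta\to0$, and $F^{\text{hom}}=\lim_{\delta\to0}F[\kappa^\delta,l]$. Embedded cell geometry: $\widetilde\Omega_c=B_{r_1}(1/2)$, $\widetilde\Omega_m=B_{r_2}(1/2)\setminus B_{r_1}(1/2)$, $\widetilde\Omega_{\text{dummy}}=\Omega\setminus(\widetilde\Omega_m\cup\widetilde\Omega_c)$, where $B_r(\bar x)$ is the closed ball of radius $r$ and $0<r_1\le r_2\le 0.1$ are chosen such that $|\Omega_c|/|\Omega_m|=|\widetilde\Omega_c|/|\widetilde\Omega_m|$. One dimensional embedded cell algorithm: set $\kappa^{\text{dummy}}(0)=|\Omega_c|\kappa_{\text{cer}}+|\Omega_m|\kappa_{\text{met}}$. For $n=1,2,\dots$: let $\kappa^{n-1}=\chi_{\widetilde\Omega_c}\kappa_{\text{cer}}+\chi_{\widetilde\Omega_m}\kappa_{\text{met}}+\chi_{\widetilde\Omega_{\text{dummy}}}\kappa^{\text{dummy}}(n-1)$,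 let $F^n=F[\kappa^{n-1},l]$, and set $\kappa^{\text{dummy}}(n)=F^n l^{-1}$. Finally $\kappa^{\text{dummy}}=\lim_{n\to\infty}\kappa^{\text{dummy}}(n)$ and $F^{\text{ECM}}=\lim_{n\to\infty}F^n$. *)

theory Defs
  imports "HOL-Analysis.Analysis"
begin

section \<open>Sobolev space on the unit interval\<close>

abbreviation Omega :: "real set" where
  "Omega \<equiv> {0<..<1}"

definition L2 :: "(real \<Rightarrow> real) set" where
  "L2 = {f. f \<in> borel_measurable (lebesgue_on Omega) \<and>
            integrable (lebesgue_on Omega) (\<lambda>x. (f x)\<^sup>2)}"

definition test_function :: "(real \<Rightarrow> real) \<Rightarrow> bool" where
  "test_function \<phi> \<longleftrightarrow>
     (\<forall>k x. (deriv ^^ k) \<phi> differentiable (at x)) \<and>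
     (\<exists>a b. 0 < a \<and> b < 1 \<and> (\<forall>x. x \<notin> {a..b} \<longrightarrow> \<phi> x = 0))"

definition has_weak_deriv :: "(real \<Rightarrow> real) \<Rightarrow> (real \<Rightarrow> real) \<Rightarrow> bool" where
  "has_weak_deriv u g \<longleftrightarrow>
     (\<forall>\<phi>. test_function \<phi> \<longrightarrow>
        (LINT x|lebesgue_on Omega. u x * deriv \<phi> x) = - (LINT x|lebesgue_on Omega. g x * \<phi> x))"

definition H1 :: "(real \<Rightarrow> real) set" where
  "H1 = {u \<in> L2. \<exists>g\<in>L2. has_weak_deriv u g}"

text \<open>A representative of the weak derivative, which is determined almost everywhere in
  \<^term>\<open>Omega\<close>.\<close>

definition weak_deriv :: "(real \<Rightarrow> real) \<Rightarrow> real \<Rightarrow> real" where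
  "weak_deriv u = (SOME g. g \<in> L2 \<and> has_weak_deriv u g)"

text \<open>Every class in \<open>H\<^sup>1(0,1)\<close> has exactly one representative that is continuous on \<open>[0,1]\<close>;
  the boundary conditions are imposed on it.\<close>

definition W :: "real \<Rightarrow> (real \<Rightarrow> real) set" where
  "W l = {u \<in> H1. continuous_on {0..1} u \<and> u 0 = 0 \<and> u 1 = l}"

text \<open>Weak convergence in the Hilbert spaces \<open>L\<^sup>2\<close> and \<open>H\<^sup>1\<close>, tested against all elements by means
  of the inner product.\<close>

definition weakly_converges_L2 ::
    "('a \<Rightarrow> real \<Rightarrow> real) \<Rightarrow> (real \<Rightarrow> real) \<Rightarrow> 'a filter \<Rightarrow> bool" where
  "weakly_converges_L2 f g F \<longleftrightarrow>
     (\<forall>\<^sub>F d in F. f d \<in> L2) \<and> g \<in> L2 \<and>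
     (\<forall>\<phi>\<in>L2. ((\<lambda>d. LINT x|lebesgue_on Omega. f d x * \<phi> x) \<longlongrightarrow>
                (LINT x|lebesgue_on Omega. g x * \<phi> x)) F)"

definition inner_H1 :: "(real \<Rightarrow> real) \<Rightarrow> (real \<Rightarrow> real) \<Rightarrow> real" where
  "inner_H1 u v = (LINT x|lebesgue_on Omega. u x * v x) +
                  (LINT x|lebesgue_on Omega. weak_deriv u x * weak_deriv v x)"

definition weakly_converges_H1 ::
    "('a \<Rightarrow> real \<Rightarrow> real) \<Rightarrow> (real \<Rightarrow> real) \<Rightarrow> 'a filter \<Rightarrow> bool" where
  "weakly_converges_H1 u v F \<longleftrightarrow>
     (\<forall>\<^sub>F d in F. u d \<in> H1) \<and> v \<in> H1 \<and>
     (\<forall>\<phi>\<in>H1. ((\<lambda>d. inner_H1 (u d) \<phi>) \<longlongrightarrow> inner_H1 v \<phi>) F)"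

section \<open>The tensile test\<close>

definition is_weak_solution :: "(real \<Rightarrow> real) \<Rightarrow> real \<Rightarrow> (real \<Rightarrow> real) \<Rightarrow> bool" where
  "is_weak_solution \<kappa> l u \<longleftrightarrow>
     u \<in> W l \<and>
     (\<forall>v\<in>W 0. (LINT x|lebesgue_on Omega. \<kappa> x * weak_deriv u x * weak_deriv v x) = 0)"

text \<open>The weak solution is unique only as a function on \<open>[0,1]\<close>, its values elsewhere being
  irrelevant; hence \<open>SOME\<close> and not \<open>THE\<close>.\<close>

definition weak_solution :: "(real \<Rightarrow> real) \<Rightarrow> real \<Rightarrow> real \<Rightarrow> real" where
  "weak_solution \<kappa> l = (SOME u. is_weak_solution \<kappa> l u)"

text \<open>The trace of \<open>\<kappa> u'\<close> at \<open>1\<close>: the constant to which \<open>\<kappa> u'\<close> is equal almost everywhere.\<close>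

definition tensile_force :: "(real \<Rightarrow> real) \<Rightarrow> real \<Rightarrow> real" where
  "tensile_force \<kappa> l =
     (THE c. AE x in lebesgue_on Omega. \<kappa> x * weak_deriv (weak_solution \<kappa> l) x = c)"

section \<open>Homogenization\<close>

text \<open>Here \<open>m\<close> is the volume fraction of the metal.\<close>

definition periodic_kappa :: "real \<Rightarrow> real \<Rightarrow> real \<Rightarrow> real \<Rightarrow> real" where
  "periodic_kappa \<kappa>met \<kappa>cer m x = (if frac x < m then \<kappa>met else \<kappa>cer)"

definition scaled_kappa :: "real \<Rightarrow> real \<Rightarrow> real \<Rightarrow> real \<Rightarrow> real \<Rightarrow> real" where
  "scaled_kappa \<kappa>met \<kappa>cer m \<delta> x = periodic_kappa \<kappa>met \<kappa>cer m (x / \<delta>)"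

definition homogenized_limit ::
    "real \<Rightarrow> real \<Rightarrow> real \<Rightarrow> real \<Rightarrow> real \<Rightarrow> (real \<Rightarrow> real) \<Rightarrow> bool" where
  "homogenized_limit \<kappa>met \<kappa>cer m l k u \<longleftrightarrow>
     u \<in> W l \<and>
     weakly_converges_H1 (\<lambda>\<delta>. weak_solution (scaled_kappa \<kappa>met \<kappa>cer m \<delta>) l) u (at_right 0) \<and>
     weakly_converges_L2
       (\<lambda>\<delta> x. scaled_kappa \<kappa>met \<kappa>cer m \<delta> x *
                weak_deriv (weak_solution (scaled_kappa \<kappa>met \<kappa>cer m \<delta>) l) x)
       (\<lambda>x. k * weak_deriv u x) (at_right 0)"

definition kappa_hom :: "real \<Rightarrow> real \<Rightarrow> real \<Rightarrow> real \<Rightarrow> real" where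
  "kappa_hom \<kappa>met \<kappa>cer m l = (THE k. \<exists>u. homogenized_limit \<kappa>met \<kappa>cer m l k u)"

definition force_hom :: "real \<Rightarrow> real \<Rightarrow> real \<Rightarrow> real \<Rightarrow> real" where
  "force_hom \<kappa>met \<kappa>cer m l =
     Lim (at_right 0) (\<lambda>\<delta>. tensile_force (scaled_kappa \<kappa>met \<kappa>cer m \<delta>) l)"

section \<open>The embedded cell algorithm\<close>

definition cell_cer :: "real \<Rightarrow> real set" where
  "cell_cer r1 = cball (1/2) r1"

definition cell_met :: "real \<Rightarrow> real \<Rightarrow> real set" where
  "cell_met r1 r2 = cball (1/2) r2 - cball (1/2) r1"

definition cell_dummy :: "real \<Rightarrow> real \<Rightarrow> real set" where
  "cell_dummy r1 r2 = Omega - (cell_met r1 r2 \<union> cell_cer r1)"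

definition cell_kappa :: "real \<Rightarrow> real \<Rightarrow> real \<Rightarrow> real \<Rightarrow> real \<Rightarrow> real \<Rightarrow> real" where
  "cell_kappa \<kappa>met \<kappa>cer r1 r2 d x =
     indicator (cell_cer r1) x * \<kappa>cer + indicator (cell_met r1 r2) x * \<kappa>met +
     indicator (cell_dummy r1 r2) x * d"

text \<open>Here \<open>m\<close> and \<open>c\<close> are the volume fractions of metal and ceramic.\<close>

primrec kappa_dummy ::
    "real \<Rightarrow> real \<Rightarrow> real \<Rightarrow> real \<Rightarrow> real \<Rightarrow> real \<Rightarrow> real \<Rightarrow> nat \<Rightarrow> real" where
  "kappa_dummy \<kappa>met \<kappa>cer m c r1 r2 l 0 = c * \<kappa>cer + m * \<kappa>met"
| "kappa_dummy \<kappa>met \<kappa>cer m c r1 r2 l (Suc n) =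
     tensile_force (cell_kappa \<kappa>met \<kappa>cer r1 r2 (kappa_dummy \<kappa>met \<kappa>cer m c r1 r2 l n)) l / l"

text \<open>\<open>F\<^sup>n\<close>, meaningful for \<open>n \<ge> 1\<close>.\<close>

definition ecm_force ::
    "real \<Rightarrow> real \<Rightarrow> real \<Rightarrow> real \<Rightarrow> real \<Rightarrow> real \<Rightarrow> real \<Rightarrow> nat \<Rightarrow> real" where
  "ecm_force \<kappa>met \<kappa>cer m c r1 r2 l n =
     tensile_force
       (cell_kappa \<kappa>met \<kappa>cer r1 r2 (kappa_dummy \<kappa>met \<kappa>cer m c r1 r2 l (n - 1))) l"

end

theory Submission
  imports Defs "HOL-Real_Asymp.Real_Asymp"
begin

text \<open>
  In one dimension the equation \<open>(\<kappa> u')' = 0\<close> is solved by hand: the stress \<open>\<kappa> u'\<close> is a constant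
  \<open>F\<close>, so \<open>u' = F / \<kappa>\<close>, and the boundary conditions give \<open>l = F \<integral> 1 / \<kappa>\<close>. The tensile force is
  therefore \<open>l\<close> divided by the compliance \<open>\<integral> 1 / \<kappa>\<close>, whatever the arrangement of the materials
  (lemma \<open>tensile_force_eq\<close>). Both halves of the theorem are statements about compliances. Write
  \<open>\<rho> = m / \<kappa>met + c / \<kappa>cer\<close>.

  For the embedded cell, the condition on the radii says that the cell contains the two materials
  in the true proportions, so its contribution to the compliance is \<open>2 r2 \<rho>\<close>, and the dummy
  material contributes \<open>(1 - 2 r2) / d\<close>. One step of the algorithm thus maps \<open>1 / d\<close> to the convex
  combination \<open>2 r2 \<rho> + (1 - 2 r2) / d\<close>, an affine contraction with fixed point \<open>\<rho>\<close>
  (lemma \<open>dummy_closed_form\<close>); hence \<open>1 / d\<close> tends to \<open>\<rho>\<close> geometrically.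

  For the homogenized problem, \<open>1 / \<kappa>\<^sup>\<delta> - \<rho>\<close> is periodic with mean zero and period \<open>\<delta>\<close>, so its
  primitive is of order \<open>\<delta>\<close> (lemma \<open>primitive_scaled_fluct_bound\<close>). This makes the compliances
  converge to \<open>\<rho>\<close>, makes \<open>u\<^sup>\<delta>\<close> converge uniformly to the linear function \<open>l x\<close>, and, since the
  fluctuations are bounded, makes them tend to zero weakly against all integrable functions
  (lemma \<open>integral_mult_tendsto_0\<close>, a form of the Riemann-Lebesgue lemma). The stresses are the
  constants \<open>l / \<integral> 1 / \<kappa>\<^sup>\<delta>\<close> and converge to \<open>l / \<rho>\<close>, which forces the homogenized modulus to be \<open>1 / \<rho>\<close>.

  What justifies the computation by hand is the description of \<open>H\<^sup>1(0,1)\<close>: a continuous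
  representative is its value at \<open>0\<close> plus the integral of its weak derivative
  (lemma \<open>H1_fundamental_theorem\<close>). This rests on the fundamental lemma of the calculus of
  variations and on the du Bois-Reymond lemma, which need smooth functions of compact support that
  approximate indicators of intervals; they are built from \<open>exp (- 1 / x)\<close>.
\<close>

section \<open>Smooth functions with compact support\<close>

text \<open>
  Smoothness is approached through finite orders: closure under sums, products and affine
  substitutions is then a plain induction on the order, generalized over the functions.
\<close>

primrec k_times_diff :: "nat \<Rightarrow> (real \<Rightarrow> real) \<Rightarrow> bool" where
  "k_times_diff 0 f \<longleftrightarrow> True"
| "k_times_diff (Suc n) f \<longleftrightarrow> (\<forall>x. f differentiable (at x)) \<and> k_times_diff n (deriv f)"

definition smooth :: "(real \<Rightarrow> real) \<Rightarrow> bool" where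
  "smooth f \<longleftrightarrow> (\<forall>n. k_times_diff n f)"

lemma smooth_iff_iterated_deriv:
  "smooth f \<longleftrightarrow> (\<forall>k x. (deriv ^^ k) f differentiable (at x))"
proof -
  have "k_times_diff n f \<longleftrightarrow> (\<forall>k<n. \<forall>x. (deriv ^^ k) f differentiable (at x))" for n
    by (induction n arbitrary: f)
      (simp_all add: All_less_Suc2 funpow_Suc_right del: funpow.simps(2))
  then show ?thesis
    unfolding smooth_def by auto
qed

lemma deriv_eqI: "(\<And>x. (f has_real_derivative g x) (at x)) \<Longrightarrow> deriv f = g"
  by (rule ext) (rule DERIV_imp_deriv)

lemma k_times_diff_Suc_D:
  "k_times_diff (Suc n) f \<Longrightarrow> (f has_real_derivative deriv f x) (at x)"
  by (simp add: DERIV_deriv_iff_real_differentiable)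

lemma k_times_diff_SucI:
  assumes "\<And>x. (f has_real_derivative g x) (at x)" "k_times_diff n g"
  shows "k_times_diff (Suc n) f"
  using assms deriv_eqI[OF assms(1)] by (auto simp: real_differentiable_def)

lemma k_times_diff_mono: "k_times_diff (Suc n) f \<Longrightarrow> k_times_diff n f"
  by (induction n arbitrary: f) auto

lemma k_times_diff_add:
  "k_times_diff n f \<Longrightarrow> k_times_diff n g \<Longrightarrow> k_times_diff n (\<lambda>x. f x + g x)"
proof (induction n arbitrary: f g)
  case (Suc n)
  show ?case
    by (rule k_times_diff_SucI[OF DERIV_add[OF Suc.prems[THEN k_times_diff_Suc_D]]])
      (use Suc in simp)
qed simp

lemma k_times_diff_mult:
  "k_times_diff n f \<Longrightarrow> k_times_diff n g \<Longrightarrow> k_times_diff n (\<lambda>x. f x * g x)"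
proof (induction n arbitrary: f g)
  case (Suc n)
  have "k_times_diff n (\<lambda>x. deriv f x * g x + deriv g x * f x)"
    using Suc.prems Suc.prems[THEN k_times_diff_mono]
    by (intro k_times_diff_add Suc.IH) simp_all
  then show ?case
    by (rule k_times_diff_SucI[OF DERIV_mult[OF Suc.prems[THEN k_times_diff_Suc_D]]])
qed simp

lemma k_times_diff_const: "k_times_diff n (\<lambda>x. c)"
proof (induction n arbitrary: c)
  case (Suc n)
  show ?case by (rule k_times_diff_SucI[OF DERIV_const Suc])
qed simp

lemma k_times_diff_affine: "k_times_diff n f \<Longrightarrow> k_times_diff n (\<lambda>x. f (a * x + b))"
proof (induction n arbitrary: f)
  case (Suc n)
  have "((\<lambda>x. f (a * x + b)) has_real_derivative a * deriv f (a * x + b)) (at x)" for x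
    by (rule DERIV_chain'[where g=f, OF _ k_times_diff_Suc_D[OF Suc.prems], THEN DERIV_cong])
       (auto intro!: derivative_eq_intros)
  then show ?case
    by (rule k_times_diff_SucI) (use Suc in \<open>auto intro: k_times_diff_mult k_times_diff_const\<close>)
qed simp

lemma smooth_mult: "smooth f \<Longrightarrow> smooth g \<Longrightarrow> smooth (\<lambda>x. f x * g x)"
  by (simp add: smooth_def k_times_diff_mult)

lemma smooth_add: "smooth f \<Longrightarrow> smooth g \<Longrightarrow> smooth (\<lambda>x. f x + g x)"
  by (simp add: smooth_def k_times_diff_add)

lemma smooth_const: "smooth (\<lambda>x. c)"
  by (simp add: smooth_def k_times_diff_const)

lemma smooth_affine: "smooth f \<Longrightarrow> smooth (\<lambda>x. f (a * x + b))"
  by (simp add: smooth_def k_times_diff_affine)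

lemma smooth_antiderivative:
  assumes "\<And>x. (f has_real_derivative g x) (at x)" "smooth g"
  shows "smooth f"
proof -
  have "k_times_diff n f" for n
    using k_times_diff_SucI[OF assms(1)] assms(2) by (cases n) (auto simp: smooth_def)
  then show ?thesis by (simp add: smooth_def)
qed

lemma smooth_deriv: "smooth f \<Longrightarrow> smooth (deriv f)"
  unfolding smooth_def by (metis k_times_diff.simps(2))

lemma smooth_has_derivative: "smooth f \<Longrightarrow> (f has_real_derivative deriv f x) (at x)"
  using k_times_diff_Suc_D smooth_def by blast

lemma smooth_continuous_on: "smooth f \<Longrightarrow> continuous_on A f"
  by (meson smooth_has_derivative DERIV_isCont continuous_at_imp_continuous_on)

text \<open>
  The functions \<open>p (1 / x) exp (- 1 / x)\<close>, extended by zero to \<open>x \<le> 0\<close>, for all polynomials \<open>p\<close>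
  together: this family is closed under differentiation, while \<open>exp (- 1 / x)\<close> alone is not.
\<close>
definition flat_exp :: "real poly \<Rightarrow> real \<Rightarrow> real" where
  "flat_exp p x = (if x > 0 then poly p (1 / x) * exp (- (1 / x)) else 0)"

lemma poly_times_exp_minus_tendsto_0: "((\<lambda>t. poly p t * exp (- t)) \<longlongrightarrow> (0::real)) at_top"
proof -
  have "((\<lambda>t. \<Sum>i\<le>degree p. coeff p i * (t ^ i / exp t)) \<longlongrightarrow> (\<Sum>i\<le>degree p. coeff p i * 0)) at_top"
    by (intro tendsto_intros tendsto_power_div_exp_0)
  then show ?thesis
    by (simp add: poly_altdef exp_minus sum_distrib_left divide_inverse mult_ac)
qed

lemma flat_exp_tendsto_0: "(flat_exp p \<longlongrightarrow> 0) (at 0)"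
proof -
  have "((\<lambda>x. poly p (inverse x) * exp (- (inverse x))) \<longlongrightarrow> 0) (at_right (0::real))"
    by (rule filterlim_compose[OF poly_times_exp_minus_tendsto_0 filterlim_inverse_at_top_right])
  then have "(flat_exp p \<longlongrightarrow> 0) (at_right 0)"
    by (rule Lim_transform_eventually)
       (auto simp: flat_exp_def eventually_at_right_field divide_simps intro!: exI[of _ 1])
  moreover have "(flat_exp p \<longlongrightarrow> 0) (at_left 0)"
    by (rule Lim_transform_eventually[OF tendsto_const])
       (auto simp: flat_exp_def eventually_at_left_field intro!: exI[of _ "-1"])
  ultimately show ?thesis
    by (simp add: filterlim_at_split)
qed

text \<open>
  With \<open>t = 1 / x\<close> one has \<open>dt / dx = - t\<^sup>2\<close>, so \<open>p t exp (- t)\<close> has the derivative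
  \<open>t\<^sup>2 (p t - p' t) exp (- t)\<close>. At the origin the difference quotient is again a member of the
  family, with \<open>t p t\<close> in place of \<open>p t\<close>, and tends to zero.
\<close>
lemma flat_exp_has_derivative:
  "(flat_exp p has_real_derivative flat_exp ([:0, 0, 1:] * (p - pderiv p)) x) (at x)"
proof -
  consider "x > 0" | "x < 0" | "x = 0" by linarith
  then show ?thesis
  proof cases
    case 1
    have "((\<lambda>x. poly p (1 / x) * exp (- (1 / x))) has_real_derivative
        flat_exp ([:0, 0, 1:] * (p - pderiv p)) x) (at x)"
      using 1
      by (auto intro!: derivative_eq_intros simp: flat_exp_def field_simps power2_eq_square)
    then show ?thesis
      by (rule has_field_derivative_transform_within_open[where S="{0<..}"])
         (use 1 in \<open>auto simp: flat_exp_def\<close>)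
  next
    case 2
    have "((\<lambda>x. 0) has_real_derivative flat_exp ([:0, 0, 1:] * (p - pderiv p)) x) (at x)"
      using 2 by (simp add: flat_exp_def)
    then show ?thesis
      by (rule has_field_derivative_transform_within_open[where S="{..<0}"])
         (use 2 in \<open>auto simp: flat_exp_def\<close>)
  next
    case 3
    have "((\<lambda>y. flat_exp p y / y) \<longlongrightarrow> 0) (at 0)"
      by (rule Lim_transform_eventually[OF flat_exp_tendsto_0[of "[:0, 1:] * p"]])
         (auto simp: flat_exp_def eventually_at_filter)
    then show ?thesis
      by (simp add: 3 has_field_derivative_iff flat_exp_def)
  qed
qed

lemma smooth_flat_exp: "smooth (flat_exp p)"
proof -
  have "k_times_diff n (flat_exp p)" for n
  proof (induction n arbitrary: p)
    case (Suc n)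
    show ?case by (rule k_times_diff_SucI[OF flat_exp_has_derivative Suc])
  qed simp
  then show ?thesis by (simp add: smooth_def)
qed

definition bump :: "real \<Rightarrow> real" where
  "bump = flat_exp 1"

lemma smooth_bump_affine: "smooth (\<lambda>x. bump (a * x + b))"
  unfolding bump_def by (rule smooth_affine[OF smooth_flat_exp])

lemma bump_nonneg: "bump x \<ge> 0"
  by (simp add: bump_def flat_exp_def)

lemma bump_le_1: "bump x \<le> 1"
  by (simp add: bump_def flat_exp_def)

lemma bump_eq_0: "x \<le> 0 \<Longrightarrow> bump x = 0"
  by (simp add: bump_def flat_exp_def)

lemma bump_tendsto_1: "filterlim f at_top F \<Longrightarrow> ((\<lambda>n. bump (f n)) \<longlongrightarrow> 1) F"
proof -
  have "((\<lambda>x::real. exp (- (inverse x))) \<longlongrightarrow> exp (- 0)) at_top"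
    by (intro tendsto_intros tendsto_inverse_0_at_top filterlim_ident)
  moreover have "\<forall>\<^sub>F x in at_top. exp (- (inverse x)) = bump x"
    using eventually_gt_at_top[of 0]
    by eventually_elim (simp add: bump_def flat_exp_def divide_inverse)
  ultimately have "(bump \<longlongrightarrow> exp (- 0)) at_top"
    by (rule Lim_transform_eventually)
  then have "(bump \<longlongrightarrow> 1) at_top" by simp
  then show "filterlim f at_top F \<Longrightarrow> ((\<lambda>n. bump (f n)) \<longlongrightarrow> 1) F"
    by (rule filterlim_compose)
qed

lemma test_function_iff:
  "test_function \<phi> \<longleftrightarrow>
     smooth \<phi> \<and> (\<exists>a b. 0 < a \<and> b < 1 \<and> (\<forall>x. x \<notin> {a..b} \<longrightarrow> \<phi> x = 0))"
  by (simp add: test_function_def smooth_iff_iterated_deriv)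

text \<open>
  With \<open>N = n + 1\<close> the factors are \<open>bump (N (N x - 1))\<close> and \<open>bump (N (N (b - x) - 1))\<close>. They vanish
  for \<open>x \<le> 1 / N\<close> and for \<open>x \<ge> b - 1 / N\<close>, which puts the support inside \<open>(0,1)\<close> as soon as
  \<open>b \<le> 1\<close>; at a fixed \<open>x\<close> in \<open>(0,b)\<close> both arguments tend to infinity, where \<open>bump\<close> tends to \<open>1\<close>.
\<close>
definition plateau :: "real \<Rightarrow> nat \<Rightarrow> real \<Rightarrow> real" where
  "plateau b n x = bump (real (Suc n) ^ 2 * x + - real (Suc n)) *
                   bump (- (real (Suc n) ^ 2) * x + (real (Suc n) ^ 2 * b - real (Suc n)))"

lemma test_function_plateau:
  assumes "b \<le> 1"
  shows "test_function (plateau b n)"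
proof -
  have "plateau b n x = 0" if "x \<notin> {1 / real (Suc n)..b - 1 / real (Suc n)}" for x
  proof -
    let ?N = "real (Suc n)"
    have N: "?N > 0" by simp
    from that consider "x < 1 / ?N" | "x > b - 1 / ?N" by fastforce
    then show ?thesis
    proof cases
      case 1
      then have "?N\<^sup>2 * x \<le> ?N\<^sup>2 * (1 / ?N)" by (intro mult_left_mono) auto
      then show ?thesis
        using N by (simp add: plateau_def power2_eq_square bump_eq_0 del: of_nat_Suc)
    next
      case 2
      then have "?N\<^sup>2 * (b - 1 / ?N) \<le> ?N\<^sup>2 * x" by (intro mult_left_mono) auto
      then show ?thesis
        using N by (simp add: plateau_def power2_eq_square bump_eq_0 algebra_simps del: of_nat_Suc)
    qed
  qed
  moreover have "0 < 1 / real (Suc n)" "b - 1 / real (Suc n) < 1"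
    using assms by (auto intro: less_le_trans[of _ b])
  moreover have "smooth (plateau b n)"
    unfolding plateau_def by (intro smooth_mult smooth_bump_affine)
  ultimately show ?thesis
    unfolding test_function_iff by blast
qed

lemma plateau_abs_le_1: "\<bar>plateau b n x\<bar> \<le> 1"
  unfolding plateau_def abs_mult
  by (intro mult_le_one) (simp_all add: bump_nonneg bump_le_1)

lemma plateau_tendsto_indicator: "(\<lambda>n. plateau b n x) \<longlonglongrightarrow> indicator {0<..<b} x"
proof -
  have lim: "(\<lambda>n. bump (real (Suc n) * (real (Suc n) * y - 1))) \<longlonglongrightarrow> indicator {0<..} y" for y
  proof (cases "y > 0")
    case True
    have "filterlim (\<lambda>n. real n * (real n * y - 1)) at_top sequentially"
      using True by real_asymp
    then have "filterlim (\<lambda>n. real (Suc n) * (real (Suc n) * y - 1)) at_top sequentially"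
      by (rule filterlim_compose[OF _ filterlim_Suc])
    from bump_tendsto_1[OF this] show ?thesis using True by simp
  next
    case False
    have "real (Suc n) * y \<le> 0" for n
      using False by (intro mult_nonneg_nonpos) auto
    then have "real (Suc n) * (real (Suc n) * y - 1) \<le> 0" for n
      by (intro mult_nonneg_nonpos) (auto intro: order_trans[OF _ zero_le_one])
    then show ?thesis using False by (simp add: bump_eq_0 del: of_nat_Suc)
  qed
  have "plateau b n x = bump (real (Suc n) * (real (Suc n) * x - 1)) *
      bump (real (Suc n) * (real (Suc n) * (b - x) - 1))" for n
    unfolding plateau_def by (intro arg_cong2[where f="(*)"] arg_cong[where f=bump])
      (simp_all add: power2_eq_square algebra_simps)
  then have "(\<lambda>n. plateau b n x) \<longlonglongrightarrow> indicator {0<..} x * indicator {0<..} (b - x)"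
    using tendsto_mult[OF lim[of x] lim[of "b - x"]] by simp
  also have "indicator {0<..} x * indicator {0<..} (b - x) = (indicator {0<..<b} x :: real)"
    by (auto split: split_indicator)
  finally show ?thesis .
qed

section \<open>Integration over the unit interval\<close>

abbreviation leb :: "real measure" where
  "leb \<equiv> lebesgue_on Omega"

interpretation leb: finite_measure leb
  by (rule finite_measure_lebesgue_on) simp

lemma measure_leb_Omega [simp]: "measure leb Omega = 1"
  by (simp add: measure_restrict_space)

lemma borel_measurable_leb: "f \<in> borel_measurable borel \<Longrightarrow> f \<in> borel_measurable leb"
  by (intro measurable_restrict_space1 measurable_completion) simp

lemma ident_measurable_leb: "(\<lambda>x. x) \<in> borel_measurable leb"
  by (rule borel_measurable_leb) simp

lemma indicator_measurable_leb:
  "A \<in> sets borel \<Longrightarrow> (indicator A :: real \<Rightarrow> real) \<in> borel_measurable leb"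
  by (rule borel_measurable_leb) simp

lemma integrable_leb_bounded_mult:
  fixes f g :: "real \<Rightarrow> real"
  assumes "integrable leb f" "g \<in> borel_measurable leb" "\<And>x. x \<in> Omega \<Longrightarrow> \<bar>g x\<bar> \<le> C"
  shows "integrable leb (\<lambda>x. g x * f x)"
proof (rule Bochner_Integration.integrable_bound)
  show "integrable leb (\<lambda>x. C * f x)" using assms by simp
  show "AE x in leb. norm (g x * f x) \<le> norm (C * f x)"
    by (intro AE_I2) (auto simp: abs_mult intro!: mult_right_mono order_trans[OF assms(3) abs_ge_self])
qed (use assms in measurable)

lemma integrable_leb_indicator_mult:
  fixes f :: "real \<Rightarrow> real"
  assumes "integrable leb f" "A \<in> sets borel"
  shows "integrable leb (\<lambda>x. indicator A x * f x)"
  by (rule integrable_leb_bounded_mult[where C=1, OF assms(1) indicator_measurable_leb[OF assms(2)]])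
    (simp split: split_indicator)

text \<open>
  The form in which density arguments are used below: the approximant may depend on the
  tolerance, but the error is uniform in the index.
\<close>
lemma tendsto_0_approx:
  fixes f :: "'i \<Rightarrow> real"
  assumes "\<And>e. e > 0 \<Longrightarrow> \<exists>g. (g \<longlongrightarrow> 0) F \<and> (\<forall>i. \<bar>f i\<bar> \<le> \<bar>g i\<bar> + e)"
  shows "(f \<longlongrightarrow> 0) F"
proof (rule tendstoI)
  fix e :: real assume "e > 0"
  then obtain g where g: "(g \<longlongrightarrow> 0) F" "\<And>i. \<bar>f i\<bar> \<le> \<bar>g i\<bar> + e / 2"
    using assms[of "e / 2"] by auto
  from tendstoD[OF g(1), of "e / 2"] \<open>e > 0\<close> have "\<forall>\<^sub>F i in F. dist (g i) 0 < e / 2" by simp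
  then show "\<forall>\<^sub>F i in F. dist (f i) 0 < e"
  proof eventually_elim
    case (elim i)
    with g(2)[of i] show ?case by simp
  qed
qed

text \<open>
  The integral from \<open>0\<close> to \<open>x\<close>. The indicator makes it meaningful for every real \<open>x\<close>: the value is
  \<open>0\<close> to the left of the unit interval and the full integral to the right of it.
\<close>
definition primitive :: "(real \<Rightarrow> real) \<Rightarrow> real \<Rightarrow> real" where
  "primitive h x = (LINT t|leb. indicator {..<x} t * h t)"

lemma primitive_ge_1: "1 \<le> x \<Longrightarrow> primitive h x = (LINT t|leb. h t)"
  unfolding primitive_def by (rule Bochner_Integration.integral_cong) auto

lemma primitive_le_0: "x \<le> 0 \<Longrightarrow> primitive h x = 0"
  unfolding primitive_def
  by (subst Bochner_Integration.integral_cong[OF refl, of _ _ "\<lambda>x. 0"]) auto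

text \<open>
  The half-lines generate the Borel sets and are stable under intersection, so it suffices that the
  sets with the property form a Dynkin system. For a countable disjoint union the common bound \<open>w\<close>
  makes the contribution of the tail small uniformly in \<open>i\<close>. The same lemma serves the fundamental
  lemma, with a constant family, and the weak convergence of oscillating functions, with a constant
  bound.
\<close>
lemma set_integral_tendsto_0_borel:
  fixes h :: "'i \<Rightarrow> real \<Rightarrow> real"
  assumes h: "\<And>i. integrable leb (h i)"
    and w: "integrable leb w"
    and bound: "\<And>i x. x \<in> Omega \<Longrightarrow> \<bar>h i x\<bar> \<le> w x"
    and lim: "\<And>x. ((\<lambda>i. primitive (h i) x) \<longlongrightarrow> 0) F"
    and A: "A \<in> sets borel"
  shows "((\<lambda>i. LINT t|leb. indicator A t * h i t) \<longlongrightarrow> 0) F"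
proof -
  have borel: "sigma_sets UNIV (range lessThan) = sets (borel :: real measure)"
    by (simp add: borel_Iio)
  have "{..<a} \<inter> {..<b} = {..<min a b}" for a b :: real by auto
  then have "Int_stable (range (lessThan :: real \<Rightarrow> _))"
    by (auto simp: Int_stable_def)
  moreover have "range (lessThan :: real \<Rightarrow> _) \<subseteq> Pow UNIV" by simp
  moreover from A have "A \<in> sigma_sets UNIV (range lessThan)" by (simp add: borel)
  ultimately show ?thesis
  proof (induction rule: sigma_sets_induct_disjoint)
    case (basic A)
    then show ?case using lim by (auto simp: primitive_def)
  next
    case empty
    show ?case by simp
  next
    case (compl A)
    have A: "A \<in> sets borel" using compl borel by simp
    have "(LINT t|leb. indicator (UNIV - A) t * h i t) =
        (LINT t|leb. h i t) - (LINT t|leb. indicator A t * h i t)" for i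
    proof -
      have "indicator (UNIV - A) t = 1 - (indicator A t :: real)" for t
        by (simp add: indicator_def)
      then show ?thesis by (simp add: left_diff_distrib h integrable_leb_indicator_mult A)
    qed
    moreover have "((\<lambda>i. (LINT t|leb. h i t)) \<longlongrightarrow> 0) F"
      using lim[of 1] by (simp add: primitive_ge_1)
    ultimately show ?case using tendsto_diff[OF _ compl.IH] by simp
  next
    case (union A)
    have A: "A n \<in> sets borel" for n using union borel by auto
    define U P where "U = (\<Union>n. A n)" and "P n = (\<Union>k<n. A k)" for n
    have [simp]: "U \<in> sets borel" "P n \<in> sets borel" for n
      using A by (auto simp: U_def P_def)
    have P_int: "(LINT t|leb. indicator (P n) t * h i t) =
        (\<Sum>k<n. LINT t|leb. indicator (A k) t * h i t)" for i n
    proof -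
      have "indicator (P n) t = (\<Sum>k<n. indicator (A k) t :: real)" for t
        unfolding P_def using union.hyps(1)
        by (intro indicator_UN_disjoint) (auto simp: disjoint_family_on_def)
      then have "(LINT t|leb. indicator (P n) t * h i t) =
          (LINT t|leb. (\<Sum>k<n. indicator (A k) t * h i t))"
        by (simp only: sum_distrib_right)
      also have "\<dots> = (\<Sum>k<n. LINT t|leb. indicator (A k) t * h i t)"
        by (intro Bochner_Integration.integral_sum integrable_leb_indicator_mult h A)
      finally show ?thesis .
    qed
    have tail: "(\<lambda>n. LINT t|leb. (indicator U t - indicator (P n) t) * w t) \<longlonglongrightarrow> (LINT t|leb. 0)"
    proof (rule integral_dominated_convergence[where w=w])
      show "AE t in leb. (\<lambda>n. (indicator U t - indicator (P n) t) * w t) \<longlonglongrightarrow> 0"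
      proof (rule AE_I2)
        fix t
        have "(\<lambda>n. (indicator U t - indicator (P n) t) * w t) \<longlonglongrightarrow> (indicator U t - indicator U t) * w t"
          unfolding U_def P_def by (intro tendsto_intros LIMSEQ_indicator_UN)
        then show "(\<lambda>n. (indicator U t - indicator (P n) t) * w t) \<longlonglongrightarrow> 0" by simp
      qed
      show "AE t in leb. norm ((indicator U t - indicator (P n) t) * w t) \<le> w t" for n
        using order_trans[OF abs_ge_zero bound]
        by (intro AE_I2) (auto split: split_indicator)
    qed (use w in \<open>auto intro!: borel_measurable_times borel_measurable_diff indicator_measurable_leb\<close>)
    have "((\<lambda>i. LINT t|leb. indicator U t * h i t) \<longlongrightarrow> 0) F"
    proof (rule tendsto_0_approx)
      fix e :: real assume "e > 0"
      with LIMSEQ_D[OF tail, of e] obtain n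
        where n: "\<bar>LINT t|leb. (indicator U t - indicator (P n) t) * w t\<bar> < e" by fastforce
      have "\<bar>LINT t|leb. indicator U t * h i t\<bar> \<le> \<bar>LINT t|leb. indicator (P n) t * h i t\<bar> + e" for i
      proof -
        have PU: "indicator (P n) t \<le> (indicator U t :: real)" for t
          by (auto simp: P_def U_def split: split_indicator)
        have D_int: "integrable leb (\<lambda>t. (indicator U t - indicator (P n) t) * f t)"
          if "integrable leb f" for f :: "real \<Rightarrow> real"
          by (simp add: left_diff_distrib integrable_leb_indicator_mult that)
        have "\<bar>(LINT t|leb. indicator U t * h i t) - (LINT t|leb. indicator (P n) t * h i t)\<bar> =
            \<bar>LINT t|leb. (indicator U t - indicator (P n) t) * h i t\<bar>"
          by (simp add: left_diff_distrib integrable_leb_indicator_mult h)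
        also have "\<dots> \<le> (LINT t|leb. (indicator U t - indicator (P n) t) * w t)"
          using PU
          by (intro integral_abs_bound_integral D_int h w)
            (auto simp: abs_mult intro!: mult_left_mono bound)
        finally show ?thesis using n by linarith
      qed
      moreover have "((\<lambda>i. LINT t|leb. indicator (P n) t * h i t) \<longlongrightarrow> 0) F"
        unfolding P_int using union.IH by (intro tendsto_null_sum) auto
      ultimately show "\<exists>g. (g \<longlongrightarrow> 0) F \<and> (\<forall>i. \<bar>LINT t|leb. indicator U t * h i t\<bar> \<le> \<bar>g i\<bar> + e)"
        by (intro exI[of _ "\<lambda>i. LINT t|leb. indicator (P n) t * h i t"]) blast
    qed
    then show ?case by (simp add: U_def)
  qed
qed

text \<open>The Lebesgue measure is the completion of the Borel measure.\<close>
lemma AE_leb_borel_set: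
  assumes "A \<in> sets leb"
  obtains B where "B \<in> sets borel" "AE x in leb. x \<in> A \<longleftrightarrow> x \<in> B"
proof -
  from assms have "A \<in> sets lebesgue" by (simp add: sets_restrict_space_iff)
  then obtain S N N' where SN: "A = S \<union> N" "N \<subseteq> N'" "N' \<in> null_sets lborel" "S \<in> sets lborel"
    by (rule sets_completionE)
  have "AE x in lborel. x \<notin> N'" using SN(3) by (rule AE_not_in)
  then have "AE x in lebesgue. x \<notin> N'" by (rule AE_completion)
  then have "AE x in leb. x \<notin> N'" by (auto simp: AE_restrict_space_iff)
  then have "AE x in leb. x \<in> A \<longleftrightarrow> x \<in> S" by eventually_elim (use SN in auto)
  with SN(4) that show thesis by auto
qed

lemma set_integral_tendsto_0:
  fixes h :: "'i \<Rightarrow> real \<Rightarrow> real"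
  assumes h: "\<And>i. integrable leb (h i)"
    and w: "integrable leb w"
    and bound: "\<And>i x. x \<in> Omega \<Longrightarrow> \<bar>h i x\<bar> \<le> w x"
    and lim: "\<And>x. ((\<lambda>i. primitive (h i) x) \<longlongrightarrow> 0) F"
    and A: "A \<in> sets leb"
  shows "((\<lambda>i. LINT t|leb. indicator A t * h i t) \<longlongrightarrow> 0) F"
proof -
  obtain B where B: "B \<in> sets borel" "AE x in leb. x \<in> A \<longleftrightarrow> x \<in> B"
    using A by (rule AE_leb_borel_set)
  have "(LINT t|leb. indicator A t * h i t) = (LINT t|leb. indicator B t * h i t)" for i
  proof (rule integral_cong_AE)
    show "AE t in leb. indicator A t * h i t = indicator B t * h i t"
      using B(2) by eventually_elim (auto simp: indicator_def)
  qed (use h[of i] A indicator_measurable_leb[OF B(1)] in measurable)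
  then show ?thesis
    using set_integral_tendsto_0_borel[OF h w bound lim B(1)] by simp
qed

text \<open>
  A bounded family whose integrals over all intervals from \<open>0\<close> vanish in the limit vanishes weakly
  against \<open>L\<^sup>1\<close>: indicators are covered by the preceding lemma, the claim is linear in \<open>f\<close>, and
  it passes to \<open>L\<^sup>1\<close>-limits because the family is bounded.
\<close>
theorem integral_mult_tendsto_0:
  fixes h :: "'i \<Rightarrow> real \<Rightarrow> real"
  assumes h: "\<And>i. h i \<in> borel_measurable leb"
    and bound: "\<And>i x. x \<in> Omega \<Longrightarrow> \<bar>h i x\<bar> \<le> C"
    and lim: "\<And>x. ((\<lambda>i. primitive (h i) x) \<longlongrightarrow> 0) F"
    and f: "integrable leb f"
  shows "((\<lambda>i. LINT t|leb. h i t * f t) \<longlongrightarrow> 0) F"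
  using f
proof induction
  case (base A c)
  have "integrable leb (h i)" for i
    using integrable_leb_bounded_mult[of "\<lambda>_. 1" "h i" C] h bound by simp
  from tendsto_mult_left_zero[OF set_integral_tendsto_0[OF this _ bound lim base(1)], of c]
  show ?case by (simp add: mult_ac)
next
  case (add f g)
  have "(LINT t|leb. h i t * (f t + g t)) = (LINT t|leb. h i t * f t) + (LINT t|leb. h i t * g t)" for i
    using add(1,2) integrable_leb_bounded_mult[OF _ h bound] by (simp add: distrib_left)
  with tendsto_add[OF add(3,4)] show ?case by simp
next
  case (lim f s)
  have C: "C \<ge> 0" using order_trans[OF abs_ge_zero bound, of "1/2"] by simp
  have "(\<lambda>n. LINT t|leb. \<bar>s n t - f t\<bar>) \<longlonglongrightarrow> (LINT t|leb. 0)"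
  \<comment> \<open>The approximants satisfy \<open>\<bar>s n t\<bar> \<le> 2 \<bar>f t\<bar>\<close>.\<close>
  proof (rule integral_dominated_convergence[where w="\<lambda>t. 3 * \<bar>f t\<bar>"])
    show "AE t in leb. (\<lambda>n. \<bar>s n t - f t\<bar>) \<longlonglongrightarrow> 0"
      by (intro AE_I2 tendsto_rabs_zero) (auto intro!: tendsto_eq_intros lim.hyps(2))
    show "AE t in leb. norm \<bar>s n t - f t\<bar> \<le> 3 * \<bar>f t\<bar>" for n
    proof (rule AE_I2)
      fix t assume "t \<in> space leb"
      from lim.hyps(3)[OF this, of n] show "norm \<bar>s n t - f t\<bar> \<le> 3 * \<bar>f t\<bar>" by simp
    qed
  qed (use lim.hyps(1,4) in auto)
  then have L1: "(\<lambda>n. C * (LINT t|leb. \<bar>s n t - f t\<bar>)) \<longlonglongrightarrow> 0"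
    by (auto intro: tendsto_eq_intros)
  show ?case
  proof (rule tendsto_0_approx)
    fix e :: real assume "e > 0"
    from LIMSEQ_D[OF L1 this] obtain n where n: "\<bar>C * (LINT t|leb. \<bar>s n t - f t\<bar>)\<bar> < e" by fastforce
    have "\<bar>LINT t|leb. h i t * f t\<bar> \<le> \<bar>LINT t|leb. h i t * s n t\<bar> + e" for i
    proof -
      note int = integrable_leb_bounded_mult[OF _ h bound]
      have "\<bar>(LINT t|leb. h i t * s n t) - (LINT t|leb. h i t * f t)\<bar> =
          \<bar>LINT t|leb. h i t * (s n t - f t)\<bar>"
        using lim.hyps(1,4) int by (simp add: right_diff_distrib)
      also have "\<dots> \<le> (LINT t|leb. C * \<bar>s n t - f t\<bar>)"
        using lim.hyps(1,4) bound
        by (intro integral_abs_bound_integral int) (auto simp: abs_mult intro!: mult_right_mono)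
      also have "\<dots> = C * (LINT t|leb. \<bar>s n t - f t\<bar>)" by simp
      finally show ?thesis using n by linarith
    qed
    with lim.IH[of n]
    show "\<exists>g. (g \<longlongrightarrow> 0) F \<and> (\<forall>i. \<bar>LINT t|leb. h i t * f t\<bar> \<le> \<bar>g i\<bar> + e)"
      by (intro exI[of _ "\<lambda>i. LINT t|leb. h i t * s n t"]) blast
  qed
qed

lemma test_function_smooth: "test_function \<phi> \<Longrightarrow> smooth \<phi>"
  by (simp add: test_function_iff)

lemma smooth_measurable: "smooth \<phi> \<Longrightarrow> \<phi> \<in> borel_measurable leb"
  by (intro borel_measurable_leb borel_measurable_continuous_onI smooth_continuous_on)

lemma smooth_bounded:
  assumes "smooth \<phi>"
  obtains C where "\<And>x. x \<in> Omega \<Longrightarrow> \<bar>\<phi> x\<bar> \<le> C"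
proof -
  have "bounded (\<phi> ` {0..1})"
    using assms by (intro compact_imp_bounded compact_continuous_image smooth_continuous_on) auto
  then obtain C where "\<forall>x\<in>{0..1}. \<bar>\<phi> x\<bar> \<le> C" by (auto simp: bounded_iff)
  then show thesis by (intro that) auto
qed

lemma integrable_mult_smooth:
  assumes "integrable leb f" "smooth \<phi>"
  shows "integrable leb (\<lambda>x. f x * \<phi> x)"
  using smooth_bounded[OF assms(2)] integrable_leb_bounded_mult[OF assms(1) smooth_measurable[OF assms(2)]]
  by (metis (no_types, lifting) mult.commute Bochner_Integration.integrable_cong)

text \<open>
  The test functions \<open>plateau b n\<close> converge boundedly to the indicator of \<open>(0,b)\<close>, so the primitive
  of \<open>g\<close> vanishes; then so does the integral of \<open>g\<close> over every measurable set.
\<close>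
theorem fundamental_lemma:
  assumes g: "integrable leb g"
    and orth: "\<And>\<phi>. test_function \<phi> \<Longrightarrow> (LINT x|leb. g x * \<phi> x) = 0"
  shows "AE x in leb. g x = 0"
proof -
  have le1: "primitive g b = 0" if "b \<le> 1" for b
  proof -
    have "(\<lambda>n. LINT x|leb. g x * plateau b n x) \<longlonglongrightarrow> (LINT x|leb. indicator {..<b} x * g x)"
    proof (rule integral_dominated_convergence[where w="\<lambda>x. \<bar>g x\<bar>"])
      have "(\<lambda>n. g x * plateau b n x) \<longlonglongrightarrow> indicator {..<b} x * g x" if "x \<in> Omega" for x
      proof -
        have "indicator {..<b} x = (indicator {0<..<b} x :: real)"
          using that by (auto split: split_indicator)
        then show ?thesis
          using tendsto_mult_left[OF plateau_tendsto_indicator[of b x], of "g x"] by (simp add: mult_ac)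
      qed
      then show "AE x in leb. (\<lambda>n. g x * plateau b n x) \<longlonglongrightarrow> indicator {..<b} x * g x"
        by (intro AE_I2) auto
      show "AE x in leb. norm (g x * plateau b n x) \<le> \<bar>g x\<bar>" for n
        by (intro AE_I2) (simp add: abs_mult mult_left_le plateau_abs_le_1)
      show "(\<lambda>x. g x * plateau b n x) \<in> borel_measurable leb" for n
        using integrable_mult_smooth[OF g test_function_smooth[OF test_function_plateau[OF that]]]
        by auto
    qed (use g in \<open>auto intro!: borel_measurable_times indicator_measurable_leb\<close>)
    then show ?thesis
      using orth[OF test_function_plateau[OF that]] by (simp add: primitive_def LIMSEQ_const_iff)
  qed
  have prim: "primitive g b = 0" for b
    using le1[of b] le1[of 1] primitive_ge_1[of b g] primitive_ge_1[of 1 g] by linarith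
  show ?thesis
  proof (rule leb.density_zero[OF g])
    fix A assume A: "A \<in> sets leb"
    have "((\<lambda>_::nat. LINT t|leb. indicator A t * g t) \<longlonglongrightarrow> 0)"
      by (rule set_integral_tendsto_0[where w="\<lambda>x. \<bar>g x\<bar>"]) (use g A prim in auto)
    then show "set_lebesgue_integral leb A g = 0"
      by (simp add: set_lebesgue_integral_def LIMSEQ_const_iff)
  qed
qed

section \<open>Primitives and weak derivatives\<close>

lemma AE_leb_neq: "AE x in leb. x \<noteq> c"
  using AE_completion[OF AE_lborel_singleton[of c]] by (auto simp: AE_restrict_space_iff)

lemma primitive_eq_HK_integral:
  assumes "integrable leb h" "x \<le> 1"
  shows "primitive h x = integral {0..x} h"
proof -
  have "primitive h x = integral Omega (\<lambda>t. indicator {..<x} t * h t)"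
    unfolding primitive_def using assms(1)
    by (intro lebesgue_integral_eq_integral integrable_leb_indicator_mult) auto
  also have "(\<lambda>t. indicator {..<x} t * h t) = (\<lambda>t. if t \<in> {..<x} then h t else 0)"
    by (auto simp: indicator_def)
  also have "integral Omega \<dots> = integral ({..<x} \<inter> Omega) h"
    by (rule integral_restrict_Int)
  also have "{..<x} \<inter> Omega = {0<..<x}"
    using assms(2) by auto
  finally show ?thesis by (simp add: integral_open_interval_real)
qed

lemma integrable_smooth: "smooth \<phi> \<Longrightarrow> integrable leb \<phi>"
  using integrable_mult_smooth[of "\<lambda>_. 1" \<phi>] by simp

lemma primitive_deriv:
  assumes "smooth \<phi>" "0 \<le> x" "x \<le> 1"
  shows "primitive (deriv \<phi>) x = \<phi> x - \<phi> 0"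
proof -
  have "(deriv \<phi> has_integral (\<phi> x - \<phi> 0)) {0..x}"
    using assms smooth_has_derivative[OF assms(1)]
    by (intro fundamental_theorem_of_calculus)
      (auto simp flip: has_real_derivative_iff_has_vector_derivative intro: has_field_derivative_at_within)
  then show ?thesis
    using assms by (simp add: primitive_eq_HK_integral integrable_smooth smooth_deriv integral_unique)
qed

lemma primitive_continuous:
  assumes h: "integrable leb h"
  shows "continuous_on A (primitive h)"
proof (rule continuous_on_sequentiallyI)
  fix u :: "nat \<Rightarrow> real" and a assume u: "u \<longlonglongrightarrow> a"
  show "(\<lambda>n. primitive h (u n)) \<longlonglongrightarrow> primitive h a"
    unfolding primitive_def
  proof (rule integral_dominated_convergence[where w="\<lambda>t. \<bar>h t\<bar>"])
    show "AE t in leb. (\<lambda>n. indicator {..<u n} t * h t) \<longlonglongrightarrow> indicator {..<a} t * h t"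
      using AE_leb_neq[of a]
    proof eventually_elim
      fix t assume "t \<noteq> a"
      then consider "t < a" | "a < t" by linarith
      then have "\<forall>\<^sub>F n in sequentially. indicator {..<a} t * h t = indicator {..<u n} t * h t"
      proof cases
        case 1
        from order_tendstoD(1)[OF u 1] show ?thesis by eventually_elim (simp add: 1)
      next
        case 2
        from order_tendstoD(2)[OF u 2] show ?thesis by eventually_elim (use 2 in simp)
      qed
      then show "(\<lambda>n. indicator {..<u n} t * h t) \<longlonglongrightarrow> indicator {..<a} t * h t"
        by (rule Lim_transform_eventually[OF tendsto_const])
    qed
  qed (use h integrable_leb_indicator_mult[OF h] in \<open>auto split: split_indicator\<close>)
qed

lemma primitive_abs_le:
  assumes "integrable leb h"
  shows "\<bar>primitive h x\<bar> \<le> (LINT t|leb. \<bar>h t\<bar>)"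
  unfolding primitive_def using assms
  by (intro integral_abs_bound_integral integrable_leb_indicator_mult)
    (auto split: split_indicator)

lemma primitive_measurable: "integrable leb h \<Longrightarrow> primitive h \<in> borel_measurable leb"
  by (intro borel_measurable_leb borel_measurable_continuous_onI primitive_continuous)

lemma primitive_cong_AE:
  assumes "integrable leb f" "integrable leb g" "AE x in leb. f x = g x"
  shows "primitive f x = primitive g x"
  unfolding primitive_def using assms(3)
  by (intro integral_cong_AE borel_measurable_integrable integrable_leb_indicator_mult assms(1,2)) auto

lemma primitive_cmult: "primitive (\<lambda>x. c * h x) x = c * primitive h x"
  by (simp add: primitive_def mult.left_commute)

lemma primitive_diff:
  assumes "integrable leb f" "integrable leb g"
  shows "primitive (\<lambda>x. f x - g x) x = primitive f x - primitive g x"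
  using assms by (simp add: primitive_def right_diff_distrib integrable_leb_indicator_mult)

lemma test_function_zero: "test_function \<phi> \<Longrightarrow> x \<le> 0 \<or> 1 \<le> x \<Longrightarrow> \<phi> x = 0"
  unfolding test_function_def by (metis atLeastAtMost_iff less_le_not_le order_trans)

text \<open>
  Integration by parts for a merely integrable \<open>h\<close>, by exchanging the order of integration over the
  triangle \<open>t < x\<close>: the inner integral of \<open>\<phi>'\<close> over \<open>(t,1)\<close> is \<open>- \<phi> t\<close>, as \<open>\<phi>\<close> vanishes at \<open>1\<close>.
\<close>
lemma primitive_has_weak_deriv:
  assumes h: "integrable leb h"
  shows "has_weak_deriv (primitive h) h"
  unfolding has_weak_deriv_def
proof (intro allI impI)
  fix \<phi> assume \<phi>: "test_function \<phi>"
  let ?d = "deriv \<phi>"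
  interpret P: pair_sigma_finite leb leb ..
  have sm: "smooth \<phi>" "smooth ?d" using \<phi> smooth_deriv test_function_smooth by auto
  have d: "integrable leb ?d" by (rule integrable_smooth[OF sm(2)])
  have tri: "integrable leb (\<lambda>x. indicator {..<x} t * ?d x)" for t
    using integrable_leb_indicator_mult[OF d, of "{t<..}"] by (simp add: indicator_def)
  note ident_measurable_leb [measurable]
  have [measurable]: "h \<in> borel_measurable leb" "?d \<in> borel_measurable leb" using h d by auto
  have "integrable (leb \<Otimes>\<^sub>M leb) (\<lambda>(x, t). ?d x * h t)"
    by (rule P.Fubini_integrable) (use h d in \<open>auto simp: abs_mult\<close>)
  then have int: "integrable (leb \<Otimes>\<^sub>M leb) (\<lambda>(x, t). indicator {..<x} t * h t * ?d x)"
  proof (rule Bochner_Integration.integrable_bound)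
    have "(\<lambda>(x, t). if t < x then h t * ?d x else 0) \<in> borel_measurable (leb \<Otimes>\<^sub>M leb)"
      by measurable
    also have "(\<lambda>(x, t). if t < x then h t * ?d x else 0) = (\<lambda>(x, t). indicator {..<x} t * h t * ?d x)"
      by (auto simp: indicator_def)
    finally show "(\<lambda>(x, t). indicator {..<x} t * h t * ?d x) \<in> borel_measurable (leb \<Otimes>\<^sub>M leb)" .
  qed (auto simp: abs_mult split: split_indicator)
  have inner: "(LINT x|leb. indicator {..<x} t * ?d x) = - \<phi> t" if t: "t \<in> Omega" for t
  proof -
    have "(LINT x|leb. indicator {..<x} t * ?d x) = (LINT x|leb. ?d x - indicator {..<t} x * ?d x)"
      using AE_leb_neq[of t]
      by (intro integral_cong_AE borel_measurable_integrable tri Bochner_Integration.integrable_diff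
            integrable_leb_indicator_mult d)
        (auto elim!: eventually_mono split: split_indicator)
    also have "\<dots> = primitive ?d 1 - primitive ?d t"
      using d by (simp add: primitive_ge_1 integrable_leb_indicator_mult) (simp add: primitive_def)
    also have "\<dots> = - \<phi> t"
      using t sm(1) test_function_zero[OF \<phi>, of 1] by (simp add: primitive_deriv)
    finally show ?thesis .
  qed
  have "(LINT x|leb. primitive h x * ?d x) = (LINT x|leb. (LINT t|leb. indicator {..<x} t * h t * ?d x))"
    by (simp add: primitive_def)
  also have "\<dots> = (LINT t|leb. (LINT x|leb. indicator {..<x} t * h t * ?d x))"
    by (rule P.Fubini_integral[OF int, symmetric])
  also have "\<dots> = (LINT t|leb. h t * (LINT x|leb. indicator {..<x} t * ?d x))"
    by (simp add: mult_ac)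
  also have "\<dots> = (LINT t|leb. - (h t * \<phi> t))"
    by (rule Bochner_Integration.integral_cong) (simp_all add: inner)
  finally show "(LINT x|leb. primitive h x * ?d x) = - (LINT x|leb. h x * \<phi> x)" by simp
qed

lemma test_function_add_cmult:
  assumes "test_function \<phi>" "test_function \<psi>"
  shows "test_function (\<lambda>x. \<phi> x + k * \<psi> x)"
proof -
  obtain a b where ab: "0 < a" "b < 1" "\<And>x. x \<notin> {a..b} \<Longrightarrow> \<phi> x = 0"
    using assms(1) unfolding test_function_def by metis
  obtain a' b' where ab': "0 < a'" "b' < 1" "\<And>x. x \<notin> {a'..b'} \<Longrightarrow> \<psi> x = 0"
    using assms(2) unfolding test_function_def by metis
  have "\<phi> x + k * \<psi> x = 0" if "x \<notin> {min a a'..max b b'}" for x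
  proof -
    from that have "x \<notin> {a..b}" "x \<notin> {a'..b'}" by auto
    with ab(3) ab'(3) show ?thesis by simp
  qed
  moreover have "0 < min a a'" "max b b' < 1" using ab ab' by auto
  moreover have "smooth (\<lambda>x. \<phi> x + k * \<psi> x)"
    using assms by (intro smooth_add smooth_mult smooth_const test_function_smooth)
  ultimately show ?thesis unfolding test_function_iff by blast
qed

text \<open>
  The antiderivative that vanishes at the left end of the line is constant on both sides of the
  support of \<open>\<psi>\<close>; the mean value zero is what makes the constant on the right vanish too.
\<close>
lemma test_function_antiderivative:
  assumes \<psi>: "test_function \<psi>" and zero: "(LINT x|leb. \<psi> x) = 0"
  obtains \<phi> where "test_function \<phi>" "deriv \<phi> = \<psi>"
proof -
  obtain a b where ab: "0 < a" "b < 1" "\<And>x. x \<notin> {a..b} \<Longrightarrow> \<psi> x = 0"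
    using \<psi> unfolding test_function_def by metis
  \<comment> \<open>Any base point to the left of the support would do; a negative one makes \<open>\<phi>\<close>
    differentiable at \<open>0\<close> from both sides by the same formula.\<close>
  define \<phi> where "\<phi> x = integral {-1..x} \<psi>" for x
  have cont: "continuous_on A \<psi>" for A
    by (rule smooth_continuous_on[OF test_function_smooth[OF \<psi>]])
  have deriv: "(\<phi> has_real_derivative \<psi> x) (at x)" for x
  proof (cases "x > -1")
    case True
    have "(\<phi> has_real_derivative \<psi> x) (at x within {-1..x+1})"
      unfolding \<phi>_def using True by (intro integral_has_real_derivative cont) auto
    then show ?thesis using True by (simp add: at_within_Icc_at)
  next
    case False
    have zero: "0 = \<phi> y" if "y \<in> {..<0}" for y
    proof -
      have "integral {-1..y} \<psi> = integral {-1..y} (\<lambda>_. 0)"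
        using that ab by (intro Henstock_Kurzweil_Integration.integral_cong) auto
      then show ?thesis by (simp add: \<phi>_def)
    qed
    have d0: "((\<lambda>_. 0) has_real_derivative \<psi> x) (at x)" using False ab by simp
    from False have "x \<in> {..<0}" by simp
    from has_field_derivative_transform_within_open[OF d0 open_lessThan this zero]
    show ?thesis .
  qed
  have "smooth \<phi>" by (rule smooth_antiderivative[OF deriv test_function_smooth[OF \<psi>]])
  have const: "\<phi> x = \<phi> y" if "x < y" "b \<le> x \<or> y \<le> a" for x y
  proof (rule DERIV_isconst2[OF that(1), symmetric])
    show "(\<phi> has_real_derivative 0) (at z)" if "x < z" "z < y" for z
      using deriv[of z] ab(3)[of z] that \<open>b \<le> x \<or> y \<le> a\<close> by auto
  qed (use that in \<open>auto intro: smooth_continuous_on[OF \<open>smooth \<phi>\<close>]\<close>)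
  have "\<phi> (-1) = 0" by (simp add: \<phi>_def)
  have left: "\<phi> x = 0" if "x < a" for x
  proof (cases x "-1 :: real" rule: linorder_cases)
    case less
    then show ?thesis using const[of x "-1"] ab(1) \<open>\<phi> (-1) = 0\<close> by auto
  next
    case greater
    then show ?thesis using const[of "-1" x] that \<open>\<phi> (-1) = 0\<close> by auto
  qed (simp add: \<open>\<phi> (-1) = 0\<close>)
  have "deriv \<phi> = \<psi>" by (rule deriv_eqI[OF deriv])
  have "\<phi> 1 = 0"
    using primitive_deriv[OF \<open>smooth \<phi>\<close>, of 1] zero left[OF ab(1)]
    by (simp add: \<open>deriv \<phi> = \<psi>\<close> primitive_ge_1)
  have "\<phi> x = 0" if "x > b" for x
  proof (cases x "1 :: real" rule: linorder_cases)
    case less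
    then show ?thesis using const[of x 1] that \<open>\<phi> 1 = 0\<close> by auto
  next
    case greater
    then show ?thesis using const[of 1 x] ab(2) \<open>\<phi> 1 = 0\<close> by auto
  qed (simp add: \<open>\<phi> 1 = 0\<close>)
  with left have "\<forall>x. x \<notin> {a..b} \<longrightarrow> \<phi> x = 0" by auto
  with ab(1,2) \<open>smooth \<phi>\<close> have "test_function \<phi>" unfolding test_function_iff by blast
  with \<open>deriv \<phi> = \<psi>\<close> that show thesis by blast
qed

lemma test_function_nonzero_integral:
  obtains p where "test_function p" "(LINT x|leb. p x) \<noteq> 0"
proof -
  have "(\<lambda>n. LINT x|leb. plateau 1 n x) \<longlonglongrightarrow> (LINT x|leb. 1)"
  proof (rule integral_dominated_convergence[where w="\<lambda>_. 1"])
    show "AE x in leb. (\<lambda>n. plateau 1 n x) \<longlonglongrightarrow> 1"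
    proof (rule AE_I2)
      fix x assume "x \<in> space leb"
      then show "(\<lambda>n. plateau 1 n x) \<longlonglongrightarrow> 1"
        using plateau_tendsto_indicator[of 1 x] by simp
    qed
    show "plateau 1 n \<in> borel_measurable leb" for n
      by (rule smooth_measurable[OF test_function_smooth[OF test_function_plateau]]) simp
  qed (auto simp: plateau_abs_le_1)
  then have "\<forall>\<^sub>F n in sequentially. (LINT x|leb. plateau 1 n x) > 0"
    by (rule order_tendstoD) simp
  then obtain n where "(LINT x|leb. plateau 1 n x) > 0"
    by (auto simp: eventually_sequentially)
  then show thesis by (intro that[OF test_function_plateau[of 1 n]]) auto
qed

text \<open>
  Fix a test function \<open>p\<close> with nonzero integral. A suitable multiple of \<open>p\<close> corrects any test
  function \<open>\<psi>\<close> to one of mean zero, which is the derivative of a test function. So \<open>w - c\<close>, with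
  \<open>c\<close> the \<open>p\<close>-weighted mean of \<open>w\<close>, is orthogonal to all test functions.
\<close>
theorem du_Bois_Reymond:
  assumes w: "integrable leb w"
    and orth: "\<And>\<phi>. test_function \<phi> \<Longrightarrow> (LINT x|leb. w x * deriv \<phi> x) = 0"
  obtains c where "AE x in leb. w x = c"
proof -
  obtain p where p: "test_function p" and p0: "(LINT x|leb. p x) \<noteq> 0"
    by (rule test_function_nonzero_integral)
  define c where "c = (LINT x|leb. w x * p x) / (LINT x|leb. p x)"
  note [simp] = integrable_smooth[OF test_function_smooth] integrable_mult_smooth[OF w test_function_smooth]
  have "(LINT x|leb. (w x - c) * \<psi> x) = 0" if \<psi>: "test_function \<psi>" for \<psi>
  proof -
    define k where "k = - (LINT x|leb. \<psi> x) / (LINT x|leb. p x)"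
    have "(LINT x|leb. \<psi> x + k * p x) = 0"
      using p0 p \<psi> by (simp add: k_def)
    with test_function_add_cmult[OF \<psi> p, of k]
    obtain \<phi> where "test_function \<phi>" "deriv \<phi> = (\<lambda>x. \<psi> x + k * p x)"
      by (rule test_function_antiderivative)
    with orth[of \<phi>] have "(LINT x|leb. w x * (\<psi> x + k * p x)) = 0" by simp
    then have "(LINT x|leb. w x * \<psi> x) + k * (LINT x|leb. w x * p x) = 0"
      using p \<psi> by (simp add: distrib_left mult.left_commute[of _ k])
    moreover have "(LINT x|leb. (w x - c) * \<psi> x) = (LINT x|leb. w x * \<psi> x) - c * (LINT x|leb. \<psi> x)"
      using \<psi> by (simp add: left_diff_distrib)
    ultimately show ?thesis by (simp add: c_def k_def)
  qed
  then have "AE x in leb. w x - c = 0"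
    using w by (intro fundamental_lemma) auto
  then show thesis by (intro that[of c]) auto
qed

lemma L2_integrable:
  assumes "f \<in> L2"
  shows "integrable leb f"
proof (rule Bochner_Integration.integrable_bound)
  show "integrable leb (\<lambda>x. 1 + (f x)\<^sup>2)" using assms by (simp add: L2_def)
  show "AE x in leb. norm (f x) \<le> norm (1 + (f x)\<^sup>2)"
  proof (rule AE_I2)
    fix x
    have "0 \<le> (\<bar>f x\<bar> - 1)\<^sup>2" "0 \<le> (f x)\<^sup>2" by simp_all
    then show "norm (f x) \<le> norm (1 + (f x)\<^sup>2)" by (simp add: power2_eq_square algebra_simps)
  qed
qed (use assms in \<open>simp add: L2_def\<close>)

lemma L2_mult_integrable:
  assumes "f \<in> L2" "g \<in> L2"
  shows "integrable leb (\<lambda>x. f x * g x)"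
proof (rule Bochner_Integration.integrable_bound)
  show "integrable leb (\<lambda>x. (f x)\<^sup>2 + (g x)\<^sup>2)" using assms by (simp add: L2_def)
  show "AE x in leb. norm (f x * g x) \<le> norm ((f x)\<^sup>2 + (g x)\<^sup>2)"
  proof (rule AE_I2)
    fix x
    have "0 \<le> (\<bar>f x\<bar> - \<bar>g x\<bar>)\<^sup>2" "0 \<le> \<bar>f x\<bar> * \<bar>g x\<bar>" "0 \<le> (f x)\<^sup>2 + (g x)\<^sup>2" by simp_all
    then have "\<bar>f x\<bar> * \<bar>g x\<bar> \<le> (f x)\<^sup>2 + (g x)\<^sup>2"
      unfolding power2_diff power2_abs by linarith
    then show "norm (f x * g x) \<le> norm ((f x)\<^sup>2 + (g x)\<^sup>2)"
      by (simp add: abs_mult)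
  qed
qed (use assms in \<open>auto simp: L2_def\<close>)

lemma L2_diff: "f \<in> L2 \<Longrightarrow> g \<in> L2 \<Longrightarrow> (\<lambda>x. f x - g x) \<in> L2"
  using L2_mult_integrable[of f g] by (auto simp: L2_def power2_diff mult.assoc)

lemma L2_bounded_mult:
  assumes "f \<in> L2" "g \<in> borel_measurable leb" "\<And>x. x \<in> Omega \<Longrightarrow> \<bar>g x\<bar> \<le> C"
  shows "(\<lambda>x. g x * f x) \<in> L2"
proof -
  have "integrable leb (\<lambda>x. (g x)\<^sup>2 * (f x)\<^sup>2)"
    using assms power_mono[OF assms(3), of _ 2]
    by (intro integrable_leb_bounded_mult[where C="C\<^sup>2"]) (auto simp: L2_def)
  then show ?thesis using assms by (auto simp: L2_def power_mult_distrib)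
qed

lemma L2_const: "(\<lambda>x. c) \<in> L2"
  by (simp add: L2_def)

lemma L2_bounded:
  assumes "g \<in> borel_measurable leb" "\<And>x. x \<in> Omega \<Longrightarrow> \<bar>g x\<bar> \<le> C"
  shows "g \<in> L2"
  using L2_bounded_mult[OF L2_const[of 1] assms] by simp

lemma primitive_L2: "integrable leb h \<Longrightarrow> primitive h \<in> L2"
  by (rule L2_bounded[OF primitive_measurable primitive_abs_le])

lemma weak_deriv_unique:
  assumes "has_weak_deriv u f" "has_weak_deriv u g" "integrable leb f" "integrable leb g"
  shows "AE x in leb. f x = g x"
proof -
  have "AE x in leb. f x - g x = 0"
  proof (rule fundamental_lemma)
    fix \<phi> assume "test_function \<phi>"
    then show "(LINT x|leb. (f x - g x) * \<phi> x) = 0"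
      using assms integrable_mult_smooth[OF _ test_function_smooth, of _ \<phi>]
      by (simp add: left_diff_distrib has_weak_deriv_def)
  qed (use assms in simp)
  then show ?thesis by auto
qed

lemma weak_deriv_H1:
  assumes "u \<in> H1"
  shows "weak_deriv u \<in> L2" "has_weak_deriv u (weak_deriv u)"
  using assms someI_ex[of "\<lambda>g. g \<in> L2 \<and> has_weak_deriv u g"]
  by (auto simp: H1_def weak_deriv_def)

lemma primitive_in_H1: "h \<in> L2 \<Longrightarrow> primitive h \<in> H1"
  using primitive_has_weak_deriv L2_integrable by (auto simp: H1_def primitive_L2)

lemma weak_deriv_primitive:
  assumes "h \<in> L2"
  shows "AE x in leb. weak_deriv (primitive h) x = h x"
  using assms weak_deriv_H1[OF primitive_in_H1[OF assms]]
  by (intro weak_deriv_unique[of "primitive h"] primitive_has_weak_deriv L2_integrable)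

lemma primitive_in_W: "h \<in> L2 \<Longrightarrow> primitive h 1 = l \<Longrightarrow> primitive h \<in> W l"
  by (simp add: W_def primitive_in_H1 primitive_continuous L2_integrable primitive_le_0)

text \<open>
  The difference between \<open>u\<close> and the primitive of its weak derivative has weak derivative zero and
  is constant almost everywhere by the du Bois-Reymond lemma, hence everywhere by continuity.
\<close>
theorem H1_fundamental_theorem:
  assumes u: "u \<in> H1" "continuous_on {0..1} u" and x: "x \<in> {0..1}"
  shows "u x = u 0 + primitive (weak_deriv u) x"
proof -
  let ?g = "weak_deriv u"
  define w where "w x = u x - primitive ?g x" for x
  have g: "integrable leb ?g" using weak_deriv_H1(1)[OF u(1)] by (rule L2_integrable)
  have ui: "integrable leb u" using u(1) by (simp add: H1_def L2_integrable)
  have pi: "integrable leb (primitive ?g)" by (rule L2_integrable[OF primitive_L2[OF g]])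
  have "integrable leb w" unfolding w_def using ui pi by simp
  moreover have "(LINT x|leb. w x * deriv \<phi> x) = 0" if \<phi>: "test_function \<phi>" for \<phi>
  proof -
    note int = integrable_mult_smooth[OF _ smooth_deriv[OF test_function_smooth[OF \<phi>]]]
    show ?thesis
      unfolding w_def
      using weak_deriv_H1(2)[OF u(1)] primitive_has_weak_deriv[OF g] \<phi> int[OF ui] int[OF pi]
      by (simp add: left_diff_distrib has_weak_deriv_def)
  qed
  ultimately obtain c where c: "AE x in leb. w x = c"
    by (rule du_Bois_Reymond)
  have w: "continuous_on {0..1} w"
    unfolding w_def by (intro continuous_intros u(2) primitive_continuous g)
  have "w x = c" if "x \<in> Omega" for x
  proof (rule ccontr)
    assume "w x \<noteq> c"
    define S where "S = {x \<in> Omega. w x \<in> - {c}}"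
    have "open S"
    proof -
      have "continuous_on Omega w" by (rule continuous_on_subset[OF w]) auto
      then have "open (Omega \<inter> w -` (- {c}))" by (intro continuous_open_preimage) auto
      then show ?thesis by (simp add: S_def vimage_def Int_def conj_commute)
    qed
    moreover have "S \<noteq> {}" using \<open>w x \<noteq> c\<close> that by (auto simp: S_def)
    moreover have "negligible S"
    proof -
      have "AE x in lebesgue. x \<notin> S"
        using c by (auto simp: AE_restrict_space_iff S_def)
      moreover have "S \<in> sets lebesgue" using \<open>open S\<close> by auto
      ultimately show ?thesis by (simp add: negligible_iff_null_sets AE_iff_null_sets)
    qed
    ultimately show False using open_not_negligible by blast
  qed
  then have "w y = c" if "y \<in> {0..1}" for y
    using that w by (intro continuous_constant_on_closure[of Omega w c y]) auto
  from this[OF x] this[of 0] show ?thesis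
    by (simp add: w_def primitive_le_0)
qed

lemma integral_weak_deriv:
  assumes "u \<in> W l"
  shows "(LINT x|leb. weak_deriv u x) = l"
  using assms H1_fundamental_theorem[of u 1] by (auto simp: W_def primitive_ge_1)

section \<open>The force of the tensile test\<close>

definition elliptic :: "(real \<Rightarrow> real) \<Rightarrow> bool" where
  "elliptic \<kappa> \<longleftrightarrow> \<kappa> \<in> borel_measurable leb \<and>
     (\<exists>a b. 0 < a \<and> (\<forall>x\<in>Omega. a \<le> \<kappa> x \<and> \<kappa> x \<le> b))"

definition compliance :: "(real \<Rightarrow> real) \<Rightarrow> real" where
  "compliance \<kappa> = (LINT x|leb. 1 / \<kappa> x)"

lemma elliptic_pos: "elliptic \<kappa> \<Longrightarrow> x \<in> Omega \<Longrightarrow> \<kappa> x > 0"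
  unfolding elliptic_def by (meson less_le_trans)

lemma elliptic_mult_L2:
  assumes "elliptic \<kappa>" "f \<in> L2"
  shows "(\<lambda>x. \<kappa> x * f x) \<in> L2"
proof -
  obtain a b where ab: "0 < a" "\<forall>x\<in>Omega. a \<le> \<kappa> x \<and> \<kappa> x \<le> b"
    using assms(1) unfolding elliptic_def by auto
  show ?thesis
    by (rule L2_bounded_mult[where C=b, OF assms(2)])
      (use assms(1) ab in \<open>force simp: elliptic_def\<close>)+
qed

lemma elliptic_inverse_L2:
  assumes "elliptic \<kappa>"
  shows "(\<lambda>x. 1 / \<kappa> x) \<in> L2"
proof -
  obtain a b where ab: "0 < a" "\<forall>x\<in>Omega. a \<le> \<kappa> x \<and> \<kappa> x \<le> b"
    using assms unfolding elliptic_def by auto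
  show ?thesis
  proof (rule L2_bounded[where C="1 / a"])
    show "\<bar>1 / \<kappa> x\<bar> \<le> 1 / a" if "x \<in> Omega" for x
      using ab that elliptic_pos[OF assms that] by (auto simp: frac_le)
  qed (use assms in \<open>auto simp: elliptic_def\<close>)
qed

lemma compliance_pos:
  assumes "elliptic \<kappa>"
  shows "compliance \<kappa> > 0"
proof -
  obtain a b where ab: "0 < a" "\<forall>x\<in>Omega. a \<le> \<kappa> x \<and> \<kappa> x \<le> b"
    using assms unfolding elliptic_def by auto
  have "b > 0" using ab(1) ab(2)[rule_format, of "1/2"] by simp
  then have "0 < (LINT x|leb. 1 / b)" by simp
  also have "\<dots> \<le> compliance \<kappa>"
    unfolding compliance_def
    using ab elliptic_pos[OF assms] L2_integrable[OF elliptic_inverse_L2[OF assms]]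
    by (intro integral_mono) (auto simp: frac_le)
  finally show ?thesis .
qed

text \<open>
  With \<open>q = \<kappa> u'\<close> and \<open>c\<close> the mean of \<open>q\<close>, the primitive of \<open>q - c\<close> is an admissible test
  displacement. Testing with it gives \<open>\<integral> q (q - c) = 0\<close>, that is \<open>\<integral> (q - c)\<^sup>2 = 0\<close>. The value of
  the constant then follows from integrating \<open>u' = c / \<kappa>\<close>.
\<close>
lemma weak_solution_stress:
  assumes \<kappa>: "elliptic \<kappa>" and u: "is_weak_solution \<kappa> l u"
  shows "AE x in leb. \<kappa> x * weak_deriv u x = l / compliance \<kappa>"
proof -
  define q where "q x = \<kappa> x * weak_deriv u x" for x
  define c where "c = (LINT x|leb. q x)"
  have uW: "u \<in> W l" using u by (simp add: is_weak_solution_def)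
  then have "weak_deriv u \<in> L2" by (simp add: W_def weak_deriv_H1)
  then have q: "q \<in> L2" unfolding q_def by (rule elliptic_mult_L2[OF \<kappa>])
  have qc: "(\<lambda>x. q x - c) \<in> L2" by (rule L2_diff[OF q L2_const])
  define v where "v = primitive (\<lambda>x. q x - c)"
  have "v \<in> W 0"
    unfolding v_def using L2_integrable[OF q]
    by (intro primitive_in_W qc) (simp add: primitive_ge_1 c_def)
  then have "(LINT x|leb. q x * weak_deriv v x) = 0"
    using u by (simp add: is_weak_solution_def q_def)
  also have "(LINT x|leb. q x * weak_deriv v x) = (LINT x|leb. q x * (q x - c))"
  proof (rule integral_cong_AE)
    show "AE x in leb. q x * weak_deriv v x = q x * (q x - c)"
      using weak_deriv_primitive[OF qc] unfolding v_def by eventually_elim simp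
    show "(\<lambda>x. q x * weak_deriv v x) \<in> borel_measurable leb"
      using \<open>v \<in> W 0\<close> q by (intro borel_measurable_integrable L2_mult_integrable) (auto simp: W_def weak_deriv_H1)
    show "(\<lambda>x. q x * (q x - c)) \<in> borel_measurable leb"
      by (intro borel_measurable_integrable L2_mult_integrable q qc)
  qed
  finally have orth: "(LINT x|leb. q x * (q x - c)) = 0" .
  have "(LINT x|leb. (q x - c) * (q x - c)) = (LINT x|leb. q x * (q x - c)) - (LINT x|leb. c * (q x - c))"
    using L2_mult_integrable[OF q qc] L2_integrable[OF qc] by (simp add: left_diff_distrib)
  also have "\<dots> = 0"
    using orth L2_integrable[OF q] by (simp add: c_def)
  finally have "AE x in leb. (q x - c) * (q x - c) = 0"
    using L2_mult_integrable[OF qc qc] by (subst (asm) integral_nonneg_eq_0_iff_AE) auto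
  then have qc_AE: "AE x in leb. q x = c" by eventually_elim simp
  have "(LINT x|leb. weak_deriv u x) = (LINT x|leb. c * (1 / \<kappa> x))"
  proof (rule integral_cong_AE)
    show "AE x in leb. weak_deriv u x = c * (1 / \<kappa> x)"
      using qc_AE AE_space by eventually_elim (use elliptic_pos[OF \<kappa>] in \<open>force simp: q_def\<close>)
    show "(\<lambda>x. c * (1 / \<kappa> x)) \<in> borel_measurable leb"
      by (intro borel_measurable_integrable integrable_mult_right L2_integrable elliptic_inverse_L2 \<kappa>)
  qed (use \<open>weak_deriv u \<in> L2\<close> in \<open>simp add: L2_def\<close>)
  then have "l = c * compliance \<kappa>"
    using integral_weak_deriv[OF uW]
    by (simp only: compliance_def integral_mult_right_zero)
  then have "c = l / compliance \<kappa>" using compliance_pos[OF \<kappa>] by simp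
  then show ?thesis using qc_AE by (simp add: q_def)
qed

lemma weak_solution_exists:
  assumes \<kappa>: "elliptic \<kappa>"
  shows "is_weak_solution \<kappa> l (primitive (\<lambda>x. l / compliance \<kappa> * (1 / \<kappa> x)))"
    (is "is_weak_solution _ _ (primitive ?h)")
proof -
  let ?c = "l / compliance \<kappa>"
  note inv = elliptic_inverse_L2[OF \<kappa>]
  have h: "?h \<in> L2"
    by (rule L2_bounded_mult[OF inv, where C="\<bar>?c\<bar>"]) auto
  have "primitive ?h \<in> W l"
    using compliance_pos[OF \<kappa>] h
    by (intro primitive_in_W) (simp_all only: primitive_cmult, simp add: primitive_ge_1 flip: compliance_def)
  moreover have "(LINT x|leb. \<kappa> x * weak_deriv (primitive ?h) x * weak_deriv v x) = 0" if v: "v \<in> W 0" for v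
  proof -
    have v': "weak_deriv v \<in> L2" using v by (simp add: W_def weak_deriv_H1)
    have "(LINT x|leb. \<kappa> x * weak_deriv (primitive ?h) x * weak_deriv v x) = (LINT x|leb. ?c * weak_deriv v x)"
    proof (rule integral_cong_AE)
      show "AE x in leb. \<kappa> x * weak_deriv (primitive ?h) x * weak_deriv v x = ?c * weak_deriv v x"
        using weak_deriv_primitive[OF h] AE_space
      proof eventually_elim
        case (elim x)
        then show ?case using elliptic_pos[OF \<kappa>, of x] by simp
      qed
      show "(\<lambda>x. \<kappa> x * weak_deriv (primitive ?h) x * weak_deriv v x) \<in> borel_measurable leb"
        using \<open>primitive ?h \<in> W l\<close>
        by (intro borel_measurable_integrable L2_mult_integrable elliptic_mult_L2 \<kappa> v')
          (simp add: W_def weak_deriv_H1)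
    qed (use L2_integrable[OF v'] in simp)
    also have "\<dots> = 0" using integral_weak_deriv[OF v] by simp
    finally show ?thesis .
  qed
  ultimately show ?thesis by (simp add: is_weak_solution_def)
qed

lemma weak_solution_is_weak_solution:
  "elliptic \<kappa> \<Longrightarrow> is_weak_solution \<kappa> l (weak_solution \<kappa> l)"
  unfolding weak_solution_def by (rule someI[where P="is_weak_solution \<kappa> l"]) (rule weak_solution_exists)

lemma weak_deriv_weak_solution:
  assumes "elliptic \<kappa>"
  shows "AE x in leb. weak_deriv (weak_solution \<kappa> l) x = l / compliance \<kappa> * (1 / \<kappa> x)"
  using weak_solution_stress[OF assms weak_solution_is_weak_solution[OF assms, of l]] AE_space
proof eventually_elim
  case (elim x)
  then show ?case using elliptic_pos[OF assms, of x] compliance_pos[OF assms] by (simp add: field_simps)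
qed

lemma weak_solution_in_W: "elliptic \<kappa> \<Longrightarrow> weak_solution \<kappa> l \<in> W l"
  using weak_solution_is_weak_solution by (simp add: is_weak_solution_def)

lemma weak_solution_eq:
  assumes \<kappa>: "elliptic \<kappa>" and x: "x \<in> {0..1}"
  shows "weak_solution \<kappa> l x = l / compliance \<kappa> * primitive (\<lambda>x. 1 / \<kappa> x) x"
proof -
  let ?u = "weak_solution \<kappa> l"
  have W: "?u \<in> H1" "continuous_on {0..1} ?u" "?u 0 = 0"
    using weak_solution_in_W[OF \<kappa>] by (auto simp: W_def)
  have "?u x = primitive (weak_deriv ?u) x"
    using H1_fundamental_theorem[OF W(1,2) x] W(3) by simp
  also have "\<dots> = primitive (\<lambda>x. l / compliance \<kappa> * (1 / \<kappa> x)) x"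
  proof (rule primitive_cong_AE[OF _ _ weak_deriv_weak_solution[OF \<kappa>]])
    show "integrable leb (weak_deriv ?u)" by (intro L2_integrable weak_deriv_H1 W)
    show "integrable leb (\<lambda>x. l / compliance \<kappa> * (1 / \<kappa> x))"
      by (intro integrable_mult_right L2_integrable elliptic_inverse_L2 \<kappa>)
  qed
  finally show ?thesis by (simp only: primitive_cmult)
qed

lemma AE_leb_const: "(AE x in leb. (a :: real) = b) \<Longrightarrow> a = b"
  using integral_cong_AE[of "\<lambda>_. a" leb "\<lambda>_. b"] by simp

theorem tensile_force_eq:
  assumes "elliptic \<kappa>"
  shows "tensile_force \<kappa> l = l / compliance \<kappa>"
proof -
  note stress = weak_solution_stress[OF assms weak_solution_is_weak_solution[OF assms], of l]
  show ?thesis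
    unfolding tensile_force_def
  proof (rule the_equality)
    show "AE x in leb. \<kappa> x * weak_deriv (weak_solution \<kappa> l) x = l / compliance \<kappa>" by (rule stress)
    fix c assume "AE x in leb. \<kappa> x * weak_deriv (weak_solution \<kappa> l) x = c"
    with stress have "AE x in leb. c = l / compliance \<kappa>" by eventually_elim simp
    then show "c = l / compliance \<kappa>" by (rule AE_leb_const)
  qed
qed

section \<open>The embedded cell algorithm\<close>

lemma cell_kappa_on_Omega:
  assumes "r1 \<le> r2" "x \<in> Omega"
  shows "cell_kappa \<kappa>met \<kappa>cer r1 r2 d x =
    (if x \<in> cball (1/2) r1 then \<kappa>cer else if x \<in> cball (1/2) r2 then \<kappa>met else d)"
  using assms subset_cball[OF assms(1), of "1/2 :: real"]
  by (auto simp: cell_kappa_def cell_cer_def cell_met_def cell_dummy_def)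

lemma elliptic_cell_kappa:
  assumes "\<kappa>met > 0" "\<kappa>cer > 0" "d > 0" "r1 \<le> r2"
  shows "elliptic (cell_kappa \<kappa>met \<kappa>cer r1 r2 d)"
  unfolding elliptic_def
proof (intro conjI exI ballI)
  show "cell_kappa \<kappa>met \<kappa>cer r1 r2 d \<in> borel_measurable leb"
    unfolding cell_kappa_def[abs_def] cell_cer_def cell_met_def cell_dummy_def
    by (intro borel_measurable_leb borel_measurable_add borel_measurable_times
        borel_measurable_indicator borel_measurable_const) auto
  show "0 < min d (min \<kappa>met \<kappa>cer)" using assms by simp
  fix x assume "x \<in> Omega"
  then show "min d (min \<kappa>met \<kappa>cer) \<le> cell_kappa \<kappa>met \<kappa>cer r1 r2 d x"
    "cell_kappa \<kappa>met \<kappa>cer r1 r2 d x \<le> max d (max \<kappa>met \<kappa>cer)"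
    by (auto simp: cell_kappa_on_Omega assms)
qed

lemma measure_leb_cball:
  fixes r :: real
  assumes "0 \<le> r" "r < 1/2"
  shows "measure leb (cball (1/2) r \<inter> Omega) = 2 * r"
proof -
  have "cball (1/2) r \<subseteq> Omega" using assms by (auto simp: cball_eq_atLeastAtMost)
  then have "measure leb (cball (1/2) r \<inter> Omega) = measure lebesgue (cball (1/2 :: real) r)"
    by (simp add: measure_restrict_space Int_absorb2)
  also have "\<dots> = 2 * r" using assms by (simp add: cball_eq_atLeastAtMost)
  finally show ?thesis .
qed

lemma compliance_cell_kappa:
  assumes "0 < r1" "r1 \<le> r2" "r2 < 1/2"
  shows "compliance (cell_kappa \<kappa>met \<kappa>cer r1 r2 d) =
    2 * r1 / \<kappa>cer + 2 * (r2 - r1) / \<kappa>met + (1 - 2 * r2) / d"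
proof -
  let ?i = "\<lambda>r x. indicator (cball (1/2) r) x :: real"
  have i: "integrable leb (?i r)" for r
    using integrable_leb_indicator_mult[of "\<lambda>_. 1" "cball (1/2) r"] by simp
  have "compliance (cell_kappa \<kappa>met \<kappa>cer r1 r2 d) =
      (LINT x|leb. ?i r1 x * (1 / \<kappa>cer) + (?i r2 x - ?i r1 x) * (1 / \<kappa>met) + (1 - ?i r2 x) * (1 / d))"
    unfolding compliance_def
    using subset_cball[OF assms(2), of "1/2 :: real"]
    by (intro Bochner_Integration.integral_cong refl)
      (auto simp: cell_kappa_on_Omega[OF assms(2)] split: split_indicator)
  also have "\<dots> = 2 * r1 * (1 / \<kappa>cer) + (2 * r2 - 2 * r1) * (1 / \<kappa>met) + (1 - 2 * r2) * (1 / d)"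
    using i assms by (simp add: measure_leb_cball)
  finally show ?thesis by (simp add: right_diff_distrib)
qed

text \<open>
  The quotients are taken in the extended nonnegative reals, where \<open>x / 0 = \<infinity>\<close> for \<open>x \<noteq> 0\<close>. The
  degenerate case \<open>r1 = r2\<close> of a cell without metal is therefore covered: it forces the metal to
  have volume fraction zero.
\<close>
lemma volume_fractions:
  assumes "Om \<in> sets lebesgue" "Oc \<in> sets lebesgue"
    and "Om \<inter> Oc = {}" "Om \<union> Oc = Omega"
    and "0 < r1" "r1 \<le> r2" "r2 < 1/2"
    and ratio: "emeasure lebesgue Oc / emeasure lebesgue Om =
         emeasure lebesgue (cell_cer r1) / emeasure lebesgue (cell_met r1 r2)"
  shows "measure lebesgue Om = (r2 - r1) / r2" "measure lebesgue Oc = r1 / r2"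
proof -
  let ?m = "measure lebesgue Om" and ?c = "measure lebesgue Oc"
  have "Om \<subseteq> Omega" "Oc \<subseteq> Omega" using assms(4) by blast+
  moreover have "Omega \<in> lmeasurable" by simp
  ultimately have lm: "Om \<in> lmeasurable" "Oc \<in> lmeasurable"
    using fmeasurableI2 assms(1,2) by blast+
  have sum: "?m + ?c = 1"
    using measure_Un3[OF lm] assms(3,4) by simp
  have em: "emeasure lebesgue Om = ennreal ?m" "emeasure lebesgue Oc = ennreal ?c"
    by (rule emeasure_eq_measure2[OF lm(1)], rule emeasure_eq_measure2[OF lm(2)])
  have cer: "emeasure lebesgue (cell_cer r1) = ennreal (2 * r1)"
    using assms(5) by (simp add: cell_cer_def cball_eq_atLeastAtMost)
  have met: "emeasure lebesgue (cell_met r1 r2) = ennreal (2 * (r2 - r1))"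
  proof -
    have "emeasure lebesgue (cell_met r1 r2) =
        emeasure lebesgue (cball (1/2) r2 :: real set) - emeasure lebesgue (cball (1/2) r1 :: real set)"
      unfolding cell_met_def using assms(5,6)
      by (intro emeasure_Diff) (auto simp: cball_eq_atLeastAtMost)
    also have "\<dots> = ennreal (2 * (r2 - r1))"
      using assms(5,6) by (simp add: cball_eq_atLeastAtMost ennreal_minus)
    finally show ?thesis .
  qed
  have ratio': "ennreal ?c / ennreal ?m = ennreal (2 * r1) / ennreal (2 * (r2 - r1))"
    using ratio by (simp only: em cer met)
  \<comment> \<open>Cross-multiplied, the ratio condition makes sense also for a vanishing denominator.\<close>
  have "?c * (r2 - r1) = ?m * r1"
  proof (cases "r1 = r2")
    case True
    have "ennreal ?c / ennreal ?m = \<infinity>"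
      using assms(5) by (simp add: ratio' True ennreal_divide_eq_top_iff)
    then have "?m = 0" by (auto simp: ennreal_divide_eq_top_iff)
    then show ?thesis by (simp add: True)
  next
    case False
    then have "r1 < r2" using assms by simp
    then have r: "ennreal ?c / ennreal ?m = ennreal (2 * r1 / (2 * (r2 - r1)))"
      using ratio' assms(5) by (simp add: divide_ennreal)
    have "?m > 0"
    proof (rule ccontr)
      assume "\<not> ?m > 0"
      then have "?m = 0" by (simp add: zero_less_measure_iff measure_le_0_iff)
      with sum r show False by simp
    qed
    then have "?c / ?m = 2 * r1 / (2 * (r2 - r1))"
      using r assms(5) \<open>r1 < r2\<close> by (simp add: divide_ennreal)
    then show ?thesis using \<open>?m > 0\<close> \<open>r1 < r2\<close> by (simp add: field_simps)
  qed
  moreover have c: "?c = 1 - ?m" using sum by simp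
  ultimately have "?m * r2 = r2 - r1" by (simp add: algebra_simps)
  then show "?m = (r2 - r1) / r2" using assms by (simp add: field_simps)
  then show "?c = r1 / r2" using assms(5,6) by (simp add: c diff_divide_distrib)
qed

context
  fixes l \<kappa>met \<kappa>cer r1 r2 m c \<rho> :: real
  assumes pos: "l > 0" "\<kappa>met > 0" "\<kappa>cer > 0"
    and r: "0 < r1" "r1 \<le> r2" "r2 < 1/2"
    and m: "m = (r2 - r1) / r2" and c: "c = r1 / r2"
    and \<rho>: "\<rho> = m / \<kappa>met + c / \<kappa>cer"
begin

abbreviation (input) "dummy \<equiv> kappa_dummy \<kappa>met \<kappa>cer m c r1 r2 l"

lemma reuss_compliance_pos: "\<rho> > 0"
  using pos r unfolding \<rho> m c by (intro add_nonneg_pos divide_nonneg_pos divide_pos_pos) auto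

text \<open>
  The cell has length \<open>2 r2\<close> and the true proportions of the materials, hence compliance \<open>2 r2 \<rho>\<close>.
\<close>
lemma tensile_force_cell:
  assumes "d > 0"
  shows "tensile_force (cell_kappa \<kappa>met \<kappa>cer r1 r2 d) l = l / (2 * r2 * \<rho> + (1 - 2 * r2) / d)"
proof -
  have "2 * r2 * \<rho> = 2 * r1 / \<kappa>cer + 2 * (r2 - r1) / \<kappa>met"
    using r pos by (simp add: \<rho> m c field_simps)
  then show ?thesis
    using tensile_force_eq[OF elliptic_cell_kappa[OF pos(2,3) assms r(2)]] compliance_cell_kappa[OF r]
    by simp
qed

text \<open>
  In terms of \<open>1 / d\<close> the iteration is affine with fixed point \<open>\<rho>\<close> and a factor \<open>1 - 2 r2\<close> between \<open>0\<close> and \<open>1\<close>.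
  Positivity is proved along with the formula because the tensile test of the next step is only
  well posed for a positive dummy coefficient.
\<close>
lemma dummy_closed_form:
  "dummy n > 0 \<and> 1 / dummy n - \<rho> = (1 - 2 * r2) ^ n * (1 / dummy 0 - \<rho>)"
proof (induction n)
  case 0
  have "0 < c * \<kappa>cer + m * \<kappa>met"
    using pos r unfolding m c by (intro add_pos_nonneg mult_nonneg_nonneg) auto
  then show ?case by simp
next
  case (Suc n)
  have "0 < 2 * r2 * \<rho> + (1 - 2 * r2) / dummy n"
    using Suc r reuss_compliance_pos by (intro add_pos_pos) auto
  moreover have step: "dummy (Suc n) = 1 / (2 * r2 * \<rho> + (1 - 2 * r2) / dummy n)"
    using Suc pos by (simp add: tensile_force_cell)
  moreover have "1 / dummy (Suc n) - \<rho> = (1 - 2 * r2) * (1 / dummy n - \<rho>)"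
    unfolding step by (simp add: algebra_simps add_divide_distrib diff_divide_distrib)
  ultimately show ?case using Suc by simp
qed

lemma dummy_tendsto: "dummy \<longlonglongrightarrow> inverse \<rho>"
proof -
  have "(\<lambda>n. (1 - 2 * r2) ^ n * (1 / dummy 0 - \<rho>) + \<rho>) \<longlonglongrightarrow> 0 * (1 / dummy 0 - \<rho>) + \<rho>"
    using r by (intro tendsto_intros LIMSEQ_realpow_zero) auto
  also have "(\<lambda>n. (1 - 2 * r2) ^ n * (1 / dummy 0 - \<rho>) + \<rho>) = (\<lambda>n. 1 / dummy n)"
    using dummy_closed_form by (metis diff_add_cancel)
  finally have "(\<lambda>n. inverse (1 / dummy n)) \<longlonglongrightarrow> inverse \<rho>"
    using reuss_compliance_pos by (intro tendsto_inverse) auto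
  then show ?thesis by simp
qed

lemma ecm_force_tendsto: "ecm_force \<kappa>met \<kappa>cer m c r1 r2 l \<longlonglongrightarrow> l * inverse \<rho>"
proof -
  have "ecm_force \<kappa>met \<kappa>cer m c r1 r2 l (Suc n) = l * dummy (Suc n)" for n
    using pos by (simp add: ecm_force_def)
  then have "(\<lambda>n. ecm_force \<kappa>met \<kappa>cer m c r1 r2 l (Suc n)) \<longlonglongrightarrow> l * inverse \<rho>"
    using tendsto_mult_left[OF LIMSEQ_Suc[OF dummy_tendsto], of l] by simp
  then show ?thesis by (rule LIMSEQ_imp_Suc)
qed

end

section \<open>Homogenization\<close>

lemma tendsto_0_of_scale_bound:
  fixes f :: "real \<Rightarrow> real"
  assumes "\<And>\<delta>. \<delta> > 0 \<Longrightarrow> \<bar>f \<delta>\<bar> \<le> C * \<delta>"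
  shows "(f \<longlongrightarrow> 0) (at_right 0)"
proof (rule Lim_null_comparison)
  show "\<forall>\<^sub>F \<delta> in at_right 0. norm (f \<delta>) \<le> C * \<delta>"
    using eventually_at_right_less[of 0] by eventually_elim (simp add: assms)
  show "((\<lambda>\<delta>. C * \<delta>) \<longlongrightarrow> 0) (at_right 0)"
    by (auto intro!: tendsto_eq_intros)
qed

context
  fixes a b m \<rho> :: real
  assumes pos: "a > 0" "b > 0" and m: "0 \<le> m" "m \<le> 1"
    and \<rho>: "\<rho> = m / a + (1 - m) / b"
begin

abbreviation (input) "fluct y \<equiv> 1 / periodic_kappa a b m y - \<rho>"

abbreviation (input) "bnd \<equiv> \<bar>1 / a - \<rho>\<bar> + \<bar>1 / b - \<rho>\<bar>"

lemma harmonic_mean_pos: "\<rho> > 0"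
proof (cases "m = 0")
  case False
  then show ?thesis using pos m unfolding \<rho> by (intro add_pos_nonneg) auto
qed (use pos \<rho> in simp)

lemma fluct_bound: "\<bar>fluct y\<bar> \<le> bnd"
  by (simp add: periodic_kappa_def)

lemma fluct_period_integral: "(fluct has_integral 0) {real k..real k + 1}"
proof -
  have fl: "frac x = x - real k" if "real k \<le> x" "x < real k + 1" for x
  proof -
    have "\<lfloor>x\<rfloor> = int k" using that by (simp add: floor_eq_iff)
    then show ?thesis by (simp add: frac_def)
  qed
  have 1: "(fluct has_integral (m * (1 / a - \<rho>))) {real k..real k + m}"
  proof -
    have "((\<lambda>_. 1 / a - \<rho>) has_integral (m * (1 / a - \<rho>))) {real k..real k + m}"
      using has_integral_const_real[of "1 / a - \<rho>" "real k" "real k + m"] m by simp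
    moreover have "fluct x = 1 / a - \<rho>" if "x \<in> {real k<..<real k + m}" for x
      using that m fl[of x] by (simp add: periodic_kappa_def)
    ultimately show ?thesis
      by (metis (no_types, lifting) has_integral_spike_interior box_real)
  qed
  have 2: "(fluct has_integral ((1 - m) * (1 / b - \<rho>))) {real k + m..real k + 1}"
  proof -
    have "((\<lambda>_. 1 / b - \<rho>) has_integral ((1 - m) * (1 / b - \<rho>))) {real k + m..real k + 1}"
      using has_integral_const_real[of "1 / b - \<rho>" "real k + m" "real k + 1"] m by simp
    moreover have "fluct x = 1 / b - \<rho>" if "x \<in> {real k + m<..<real k + 1}" for x
      using that m fl[of x] by (simp add: periodic_kappa_def)
    ultimately show ?thesis
      by (metis (no_types, lifting) has_integral_spike_interior box_real)
  qed
  have "m * (1 / a - \<rho>) + (1 - m) * (1 / b - \<rho>) = m / a + (1 - m) / b - \<rho>"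
    by (simp add: algebra_simps diff_divide_distrib)
  then have "m * (1 / a - \<rho>) + (1 - m) * (1 / b - \<rho>) = 0"
    by (simp add: \<rho>)
  then show ?thesis using has_integral_combine[OF _ _ 1 2] m by simp
qed

lemma fluct_integral_0: "(fluct has_integral 0) {0..real n}"
proof (induction n)
  case 0
  show ?case using has_integral_refl(2)[of fluct 0] by simp
next
  case (Suc n)
  then show ?case
    using has_integral_combine[OF _ _ Suc fluct_period_integral] by (simp add: add.commute)
qed

text \<open>
  Whole periods contribute nothing, so only the last incomplete period counts: the bound does not
  depend on \<open>y\<close>.
\<close>
lemma fluct_integral:
  assumes "y \<ge> 0"
  obtains i where "(fluct has_integral i) {0..y}" "\<bar>i\<bar> \<le> bnd"
proof -
  define n where "n = nat \<lfloor>y\<rfloor>"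
  have n: "real n \<le> y" "y \<le> real n + 1" using assms by (auto simp: n_def)
  have "fluct integrable_on {real n..y}"
    by (rule integrable_on_subinterval[OF has_integral_integrable[OF fluct_period_integral[of n]]])
      (use n in auto)
  then obtain i where i: "(fluct has_integral i) {real n..y}" by (auto simp: integrable_on_def)
  have "norm i \<le> bnd * (y - real n)"
    using has_integral_bound_real[of bnd "{}" fluct i "real n" y] i fluct_bound n by simp
  also have "\<dots> \<le> bnd * 1" using n by (intro mult_left_mono) auto
  finally have "\<bar>i\<bar> \<le> bnd" by simp
  moreover have "(fluct has_integral (0 + i)) {0..y}"
    using n by (intro has_integral_combine[OF _ _ fluct_integral_0 i]) auto
  ultimately show thesis using that by simp
qed

abbreviation (input) "ks \<equiv> scaled_kappa a b m"

lemma scaled_kappa_cases: "ks \<delta> x = a \<or> ks \<delta> x = b"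
  by (simp add: scaled_kappa_def periodic_kappa_def)

lemma elliptic_scaled_kappa: "elliptic (ks \<delta>)"
  unfolding elliptic_def
proof (intro conjI exI ballI)
  have "(\<lambda>x::real. x - real_of_int \<lfloor>x\<rfloor>) \<in> borel_measurable borel"
    by (intro borel_measurable_diff borel_measurable_real_floor) simp
  then have [measurable]: "(frac :: real \<Rightarrow> real) \<in> borel_measurable borel"
    by (simp add: frac_def[abs_def])
  have "(\<lambda>x. if frac (x / \<delta>) < m then a else b) \<in> borel_measurable borel"
    by measurable
  then show "ks \<delta> \<in> borel_measurable leb"
    by (intro borel_measurable_leb) (simp add: scaled_kappa_def[abs_def] periodic_kappa_def)
  show "0 < min a b" using pos by simp
  show "min a b \<le> ks \<delta> x" "ks \<delta> x \<le> max a b" for x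
    using scaled_kappa_cases[of \<delta> x] by auto
qed

abbreviation (input) "scaled_fluct \<delta> x \<equiv> 1 / ks \<delta> x - \<rho>"

lemma scaled_fluct_bound: "\<bar>scaled_fluct \<delta> x\<bar> \<le> bnd"
  using fluct_bound by (simp add: scaled_kappa_def)

lemma inverse_ks_L2: "(\<lambda>x. 1 / ks \<delta> x) \<in> L2"
  by (rule elliptic_inverse_L2[OF elliptic_scaled_kappa])

lemma scaled_fluct_L2: "scaled_fluct \<delta> \<in> L2"
  by (rule L2_diff[OF inverse_ks_L2 L2_const])

text \<open>
  Rescaling by \<open>\<delta>\<close> turns the uniform bound on the integral of the periodic fluctuation into a bound
  of order \<open>\<delta>\<close>.
\<close>
lemma primitive_scaled_fluct_bound:
  assumes "\<delta> > 0"
  shows "\<bar>primitive (scaled_fluct \<delta>) x\<bar> \<le> bnd * \<delta>"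
proof -
  have unit: "\<bar>primitive (scaled_fluct \<delta>) x\<bar> \<le> bnd * \<delta>" if x: "0 \<le> x" "x \<le> 1" for x
  proof -
    obtain i where i: "(fluct has_integral i) {0..x / \<delta>}" "\<bar>i\<bar> \<le> bnd"
      using fluct_integral[of "x / \<delta>"] x assms by auto
    have "((\<lambda>t. fluct (1 / \<delta> * t)) has_integral (1 / \<bar>1 / \<delta>\<bar>) *\<^sub>R i) ((\<lambda>t. t / (1 / \<delta>)) ` {0..x / \<delta>})"
      using has_integral_stretch_real[OF i(1), of "1 / \<delta>"] assms by simp
    also have "(\<lambda>t. t / (1 / \<delta>)) ` {0..x / \<delta>} = {0..x}"
      using assms x by (simp add: image_mult_atLeastAtMost_if mult.commute[of _ \<delta>])
    finally have "(scaled_fluct \<delta> has_integral \<delta> * i) {0..x}"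
      using assms by (simp add: scaled_kappa_def)
    then have "primitive (scaled_fluct \<delta>) x = \<delta> * i"
      using x by (simp add: primitive_eq_HK_integral L2_integrable[OF scaled_fluct_L2] integral_unique)
    then show ?thesis using i(2) assms by (simp add: abs_mult mult.commute)
  qed
  consider "x \<le> 0" | "0 \<le> x" "x \<le> 1" | "1 \<le> x" by linarith
  then show ?thesis
  proof cases
    case 1
    then show ?thesis using unit[of 0] by (simp add: primitive_le_0)
  next
    case 3
    then show ?thesis using unit[of 1] by (simp add: primitive_ge_1)
  qed (rule unit)
qed

lemma primitive_scaled_fluct_tendsto: "((\<lambda>\<delta>. primitive (scaled_fluct \<delta>) x) \<longlongrightarrow> 0) (at_right 0)"
  by (rule tendsto_0_of_scale_bound[OF primitive_scaled_fluct_bound])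

lemma primitive_inverse_ks:
  "primitive (\<lambda>x. 1 / ks \<delta> x) x = primitive (\<lambda>_. \<rho>) x + primitive (scaled_fluct \<delta>) x"
  using primitive_diff[OF L2_integrable[OF inverse_ks_L2] L2_integrable[OF L2_const[of \<rho>]]] by simp

lemma compliance_tendsto: "((\<lambda>\<delta>. compliance (ks \<delta>)) \<longlongrightarrow> \<rho>) (at_right 0)"
proof -
  have "compliance (ks \<delta>) = \<rho> + primitive (scaled_fluct \<delta>) 1" for \<delta>
    using primitive_inverse_ks[of \<delta> 1] by (simp add: compliance_def primitive_ge_1)
  then show ?thesis
    using tendsto_add[OF tendsto_const primitive_scaled_fluct_tendsto, of \<rho> 1] by simp
qed

lemma tensile_force_tendsto:
  "((\<lambda>\<delta>. tensile_force (ks \<delta>) l) \<longlongrightarrow> l / \<rho>) (at_right 0)"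
  using harmonic_mean_pos
  by (simp add: tensile_force_eq[OF elliptic_scaled_kappa])
    (intro tendsto_intros compliance_tendsto, simp)

lemma force_hom_eq: "force_hom a b m l = l / \<rho>"
  unfolding force_hom_def by (rule tendsto_Lim[OF trivial_limit_at_right_real tensile_force_tendsto])

text \<open>
  Up to the factor \<open>l / \<integral> 1 / \<kappa>\<^sup>\<delta>\<close>, the displacement differs from a linear function by a primitive
  of the fluctuation, which is uniformly of order \<open>\<delta>\<close>.
\<close>
lemma weak_limit_displacement:
  assumes f: "integrable leb f"
  shows "((\<lambda>\<delta>. LINT x|leb. weak_solution (ks \<delta>) l x * f x) \<longlongrightarrow>
    (LINT x|leb. primitive (\<lambda>_. l) x * f x)) (at_right 0)"
proof -
  have int: "integrable leb (\<lambda>x. primitive h x * f x)" if "h \<in> L2" for h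
    using that
    by (intro integrable_leb_bounded_mult[OF f primitive_measurable primitive_abs_le] L2_integrable)
  have "(LINT x|leb. weak_solution (ks \<delta>) l x * f x) =
      l / compliance (ks \<delta>) * ((LINT x|leb. primitive (\<lambda>_. \<rho>) x * f x) + (LINT x|leb. primitive (scaled_fluct \<delta>) x * f x))" for \<delta>
  proof -
    have "(LINT x|leb. weak_solution (ks \<delta>) l x * f x) =
        (LINT x|leb. l / compliance (ks \<delta>) * (primitive (\<lambda>_. \<rho>) x * f x + primitive (scaled_fluct \<delta>) x * f x))"
      by (intro Bochner_Integration.integral_cong refl)
        (simp add: weak_solution_eq[OF elliptic_scaled_kappa] primitive_inverse_ks distrib_right)
    then show ?thesis using int[OF L2_const] int[OF scaled_fluct_L2] by simp
  qed
  moreover have "((\<lambda>\<delta>. LINT x|leb. primitive (scaled_fluct \<delta>) x * f x) \<longlongrightarrow> 0) (at_right 0)"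
  proof (rule tendsto_0_of_scale_bound)
    fix \<delta> :: real assume \<delta>: "\<delta> > 0"
    have "\<bar>LINT x|leb. primitive (scaled_fluct \<delta>) x * f x\<bar> \<le> (LINT x|leb. bnd * \<delta> * \<bar>f x\<bar>)"
      using f primitive_scaled_fluct_bound[OF \<delta>]
      by (intro integral_abs_bound_integral int scaled_fluct_L2) (auto simp: abs_mult intro!: mult_right_mono)
    then show "\<bar>LINT x|leb. primitive (scaled_fluct \<delta>) x * f x\<bar> \<le> (bnd * (LINT x|leb. \<bar>f x\<bar>)) * \<delta>"
      by (simp add: mult_ac)
  qed
  ultimately have "((\<lambda>\<delta>. LINT x|leb. weak_solution (ks \<delta>) l x * f x) \<longlongrightarrow>
      l / \<rho> * ((LINT x|leb. primitive (\<lambda>_. \<rho>) x * f x) + 0)) (at_right 0)"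
    using harmonic_mean_pos by (simp only:) (intro tendsto_intros compliance_tendsto, simp_all)
  also have "l / \<rho> * ((LINT x|leb. primitive (\<lambda>_. \<rho>) x * f x) + 0) =
      (LINT x|leb. l / \<rho> * primitive (\<lambda>_. \<rho>) x * f x)"
    by (simp add: mult.assoc)
  also have "(\<lambda>x. l / \<rho> * primitive (\<lambda>_. \<rho>) x * f x) = (\<lambda>x. primitive (\<lambda>_. l) x * f x)"
    using harmonic_mean_pos by (simp flip: primitive_cmult)
  finally show ?thesis .
qed

text \<open>
  Strains need not converge strongly; their oscillating part is removed by the Riemann-Lebesgue type
  lemma \<open>integral_mult_tendsto_0\<close>.
\<close>
lemma weak_limit_strain:
  assumes f: "f \<in> L2"
  shows "((\<lambda>\<delta>. LINT x|leb. weak_deriv (weak_solution (ks \<delta>) l) x * f x) \<longlongrightarrow>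
    (LINT x|leb. l * f x)) (at_right 0)"
proof -
  have fi: "integrable leb f" by (rule L2_integrable[OF f])
  have u: "weak_solution (ks \<delta>) l \<in> H1" for \<delta>
    using weak_solution_in_W[OF elliptic_scaled_kappa] by (auto simp: W_def)
  have "(LINT x|leb. weak_deriv (weak_solution (ks \<delta>) l) x * f x) =
      l / compliance (ks \<delta>) * (\<rho> * (LINT x|leb. f x) + (LINT x|leb. scaled_fluct \<delta> x * f x))" for \<delta>
  proof -
    have "(LINT x|leb. weak_deriv (weak_solution (ks \<delta>) l) x * f x) =
        (LINT x|leb. l / compliance (ks \<delta>) * (\<rho> * f x + scaled_fluct \<delta> x * f x))"
    proof (rule integral_cong_AE)
      show "AE x in leb. weak_deriv (weak_solution (ks \<delta>) l) x * f x =
          l / compliance (ks \<delta>) * (\<rho> * f x + scaled_fluct \<delta> x * f x)"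
        using weak_deriv_weak_solution[OF elliptic_scaled_kappa, of \<delta> l]
        by eventually_elim (simp add: algebra_simps)
      show "(\<lambda>x. weak_deriv (weak_solution (ks \<delta>) l) x * f x) \<in> borel_measurable leb"
        by (intro borel_measurable_integrable L2_mult_integrable weak_deriv_H1 u f)
      show "(\<lambda>x. l / compliance (ks \<delta>) * (\<rho> * f x + scaled_fluct \<delta> x * f x)) \<in> borel_measurable leb"
        by (intro borel_measurable_integrable integrable_mult_right Bochner_Integration.integrable_add
            fi L2_mult_integrable[OF scaled_fluct_L2 f])
    qed
    then show ?thesis using fi L2_mult_integrable[OF scaled_fluct_L2 f] by simp
  qed
  moreover have "((\<lambda>\<delta>. LINT x|leb. scaled_fluct \<delta> x * f x) \<longlongrightarrow> 0) (at_right 0)"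
    by (rule integral_mult_tendsto_0[OF _ scaled_fluct_bound primitive_scaled_fluct_tendsto fi]) (use scaled_fluct_L2 in \<open>simp add: L2_def\<close>)
  ultimately have "((\<lambda>\<delta>. LINT x|leb. weak_deriv (weak_solution (ks \<delta>) l) x * f x) \<longlongrightarrow>
      l / \<rho> * (\<rho> * (LINT x|leb. f x) + 0)) (at_right 0)"
    using harmonic_mean_pos by (simp only:) (intro tendsto_intros compliance_tendsto, simp_all)
  then show ?thesis using harmonic_mean_pos by simp
qed

text \<open>In contrast to the strain, the stress is almost everywhere constant for each \<open>\<delta>\<close>, so it converges strongly.\<close>
lemma weak_limit_stress:
  assumes f: "f \<in> L2"
  shows "((\<lambda>\<delta>. LINT x|leb. ks \<delta> x * weak_deriv (weak_solution (ks \<delta>) l) x * f x) \<longlongrightarrow>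
    l / \<rho> * (LINT x|leb. f x)) (at_right 0)"
proof -
  have "(LINT x|leb. ks \<delta> x * weak_deriv (weak_solution (ks \<delta>) l) x * f x) =
      l / compliance (ks \<delta>) * (LINT x|leb. f x)" for \<delta>
  proof -
    have "(LINT x|leb. ks \<delta> x * weak_deriv (weak_solution (ks \<delta>) l) x * f x) =
        (LINT x|leb. l / compliance (ks \<delta>) * f x)"
    proof (rule integral_cong_AE)
      show "AE x in leb. ks \<delta> x * weak_deriv (weak_solution (ks \<delta>) l) x * f x = l / compliance (ks \<delta>) * f x"
        using weak_solution_stress[OF elliptic_scaled_kappa weak_solution_is_weak_solution[OF elliptic_scaled_kappa],
            of \<delta> l]
        by eventually_elim simp
      show "(\<lambda>x. ks \<delta> x * weak_deriv (weak_solution (ks \<delta>) l) x * f x) \<in> borel_measurable leb"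
        using weak_solution_in_W[OF elliptic_scaled_kappa]
        by (intro borel_measurable_integrable L2_mult_integrable elliptic_mult_L2 elliptic_scaled_kappa f
            weak_deriv_H1) (auto simp: W_def)
    qed (use L2_integrable[OF f] in simp)
    then show ?thesis by simp
  qed
  then show ?thesis
    using harmonic_mean_pos by (simp only:) (intro tendsto_intros compliance_tendsto, simp)
qed

theorem homogenized_limit_harmonic_mean:
  "homogenized_limit a b m l (1 / \<rho>) (primitive (\<lambda>_. l))"
proof -
  let ?u = "primitive (\<lambda>_. l)"
  have uW: "?u \<in> W l"
    by (intro primitive_in_W L2_const) (simp add: primitive_ge_1)
  then have u: "?u \<in> H1" by (simp add: W_def)
  have us: "weak_solution (ks \<delta>) l \<in> H1" for \<delta>
    using weak_solution_in_W[OF elliptic_scaled_kappa] by (auto simp: W_def)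
  have du: "(LINT x|leb. weak_deriv ?u x * f x) = (LINT x|leb. l * f x)" if f: "f \<in> L2" for f
  proof (rule integral_cong_AE)
    show "AE x in leb. weak_deriv ?u x * f x = l * f x"
      using weak_deriv_primitive[OF L2_const[of l]] by eventually_elim simp
    show "(\<lambda>x. weak_deriv ?u x * f x) \<in> borel_measurable leb"
      by (intro borel_measurable_integrable L2_mult_integrable weak_deriv_H1 u f)
  qed (use L2_integrable[OF f] in simp)
  have "weakly_converges_H1 (\<lambda>\<delta>. weak_solution (ks \<delta>) l) ?u (at_right 0)"
    unfolding weakly_converges_H1_def inner_H1_def
  proof (intro conjI ballI always_eventually allI us u tendsto_add)
    fix v assume v: "v \<in> H1"
    show "((\<lambda>\<delta>. LINT x|leb. weak_solution (ks \<delta>) l x * v x) \<longlongrightarrow> (LINT x|leb. ?u x * v x)) (at_right 0)"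
      using v by (intro weak_limit_displacement L2_integrable) (simp add: H1_def)
    show "((\<lambda>\<delta>. LINT x|leb. weak_deriv (weak_solution (ks \<delta>) l) x * weak_deriv v x) \<longlongrightarrow>
        (LINT x|leb. weak_deriv ?u x * weak_deriv v x)) (at_right 0)"
      using weak_limit_strain du weak_deriv_H1(1)[OF v] by simp
  qed
  moreover have "weakly_converges_L2 (\<lambda>\<delta> x. ks \<delta> x * weak_deriv (weak_solution (ks \<delta>) l) x)
      (\<lambda>x. 1 / \<rho> * weak_deriv ?u x) (at_right 0)"
    unfolding weakly_converges_L2_def
  proof (intro conjI ballI always_eventually allI)
    show "(\<lambda>x. ks \<delta> x * weak_deriv (weak_solution (ks \<delta>) l) x) \<in> L2" for \<delta>
      by (intro elliptic_mult_L2 elliptic_scaled_kappa weak_deriv_H1 us)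
    show "(\<lambda>x. 1 / \<rho> * weak_deriv ?u x) \<in> L2"
      by (rule L2_bounded_mult[where C="\<bar>1 / \<rho>\<bar>", OF weak_deriv_H1(1)[OF u]]) auto
    fix f assume f: "f \<in> L2"
    have eq: "(LINT x|leb. 1 / \<rho> * weak_deriv ?u x * f x) = l / \<rho> * (LINT x|leb. f x)"
      using du[OF f] by (simp add: mult.assoc)
    show "((\<lambda>\<delta>. LINT x|leb. ks \<delta> x * weak_deriv (weak_solution (ks \<delta>) l) x * f x) \<longlongrightarrow>
        (LINT x|leb. 1 / \<rho> * weak_deriv ?u x * f x)) (at_right 0)"
      unfolding eq by (rule weak_limit_stress[OF f])
  qed
  ultimately show ?thesis using uW by (simp add: homogenized_limit_def)
qed

text \<open>
  Testing the convergence of the stresses with the constant function \<open>1\<close> suffices: the mean of the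
  weak derivative of any \<open>u\<close> in \<open>W l\<close> is \<open>l\<close>, so that \<open>k l = l / \<rho>\<close>.
\<close>
lemma homogenized_limit_unique:
  assumes "homogenized_limit a b m l k u" "l \<noteq> 0"
  shows "k = 1 / \<rho>"
proof -
  have "((\<lambda>\<delta>. LINT x|leb. ks \<delta> x * weak_deriv (weak_solution (ks \<delta>) l) x * 1) \<longlongrightarrow>
      (LINT x|leb. k * weak_deriv u x * 1)) (at_right 0)"
    using assms(1) unfolding homogenized_limit_def weakly_converges_L2_def
    by (elim conjE) (erule bspec, rule L2_const)
  from tendsto_unique[OF trivial_limit_at_right_real this weak_limit_stress[OF L2_const[of 1]]]
  have "k * (LINT x|leb. weak_deriv u x) = l / \<rho>" by simp
  then have "k * l = 1 / \<rho> * l"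
    using assms(1) integral_weak_deriv[of u l] by (simp add: homogenized_limit_def)
  then show ?thesis by (simp only: mult_right_cancel[OF assms(2)])
qed

lemma kappa_hom_eq:
  assumes "l \<noteq> 0"
  shows "kappa_hom a b m l = 1 / \<rho>"
  unfolding kappa_hom_def
  using homogenized_limit_harmonic_mean homogenized_limit_unique[OF _ assms] by blast

end

theorem theorem4p1:
  fixes l \<kappa>met \<kappa>cer r1 r2 m c :: real
    and Om Oc :: "real set"
  assumes "l > 0" and "\<kappa>met > 0" and "\<kappa>cer > 0"
    and "Om \<in> sets lebesgue" and "Oc \<in> sets lebesgue"
    and "Om \<inter> Oc = {}" and "Om \<union> Oc = Omega"
    and "m = measure lebesgue Om" and "c = measure lebesgue Oc"
    and "0 < r1" and "r1 \<le> r2" and "r2 \<le> 1/10"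
    and "emeasure lebesgue Oc / emeasure lebesgue Om =
         emeasure lebesgue (cell_cer r1) / emeasure lebesgue (cell_met r1 r2)"
  shows "kappa_dummy \<kappa>met \<kappa>cer m c r1 r2 l \<longlonglongrightarrow> inverse (m / \<kappa>met + c / \<kappa>cer) \<and>
         ecm_force \<kappa>met \<kappa>cer m c r1 r2 l \<longlonglongrightarrow> l * inverse (m / \<kappa>met + c / \<kappa>cer) \<and>
         (\<exists>!k. \<exists>u. homogenized_limit \<kappa>met \<kappa>cer m l k u) \<and>
         lim (kappa_dummy \<kappa>met \<kappa>cer m c r1 r2 l) = kappa_hom \<kappa>met \<kappa>cer m l \<and>
         ((\<lambda>\<delta>. tensile_force (scaled_kappa \<kappa>met \<kappa>cer m \<delta>) l) \<longlongrightarrow>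
           force_hom \<kappa>met \<kappa>cer m l) (at_right 0) \<and>
         lim (ecm_force \<kappa>met \<kappa>cer m c r1 r2 l) = force_hom \<kappa>met \<kappa>cer m l"
proof -
  let ?\<rho> = "m / \<kappa>met + c / \<kappa>cer"
  have r2: "r2 < 1/2" using assms(12) by simp
  have m: "m = (r2 - r1) / r2" and c: "c = r1 / r2"
    unfolding assms(8,9) by (rule volume_fractions[OF assms(4-7,10,11) r2 assms(13)])+
  have m01: "0 \<le> m" "m \<le> 1" and \<rho>: "?\<rho> = m / \<kappa>met + (1 - m) / \<kappa>cer"
    using assms(10,11) by (auto simp: m c diff_divide_distrib)
  note alg = assms(1-3,10,11) r2 m c refl
  note hom = assms(2,3) m01 \<rho>
  have l: "l \<noteq> 0" using assms(1) by simp
  note d = dummy_tendsto[OF alg] and f = ecm_force_tendsto[OF alg]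
  have "\<exists>!k. \<exists>u. homogenized_limit \<kappa>met \<kappa>cer m l k u"
    using homogenized_limit_harmonic_mean[OF hom] homogenized_limit_unique[OF hom _ l] by blast
  then show ?thesis
    using d f limI[OF d] limI[OF f] kappa_hom_eq[OF hom l] force_hom_eq[OF hom] tensile_force_tendsto[OF hom]
    by (simp add: divide_inverse)
qed

end
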